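(* Let $A$ and $B$ be invertible positive operators on a Hilbert space $\mathscr{H}$ such that $A\le B$, and let $p\in(0,1]$. Then $$L_p(A,B)+K_p(A,B)\le T_p(A|B)\le R_p(A,B)+K_p(A,B)$$ and $$J_p(A,B)-2R_p(A,B)\le T_p(A|B)\le J_p(A,B)-2L_p(A,B),$$ where $$K_p(A,B):=A^{1/2}\left(\frac{A^{-1/2}BA^{-1/2}+I}{2}\right)^{p-1}\left(A^{-1/2}BA^{-1/2}-I\right)A^{1/2},$$ $$J_p(A,B):=\frac12\left(A\#_pB-A\natural_{p-1}B+B-A\right),$$ $$L_p(A,B):=\frac1{24}(p-1)(p-2)\left(A\#_pB-3A\natural_{p-1}B+3A\natural_{p-2}B-A\natural_{p-3}B\right),$$ $$R_p(A,B):=\frac1{24}(p-1)(p-2)\left(A\natural_3B-3A\natural_2B+3B-A\right).$$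
   Context: Operators are bounded linear operators on a Hilbert space $\mathscr{H}$, $I$ is the identity operator, and $X\le Y$ denotes the usual (Loewner) order on self-adjoint operators, i.e. $Y-X$ is positive (positive semidefinite). For invertible positive operators $A,B$ and $r\in\mathbb{R}$, define $A\natural_r B:=A^{\frac12}\left(A^{-\frac12}BA^{-\frac12}\right)^{r}A^{\frac12}$; for $r=p\in[0,1]$ this is written $A\#_pB$. For $p\in(0,1]$, the Tsallis relative operator entropy is $T_p(A|B):=\dfrac{A\#_pB-A}{p}$. *)

theory Defs
  imports "HOL-Analysis.Analysis" "HOL-Computational_Algebra.Polynomial"
begin

class complex_space = banach +
  fixes scaleC :: "complex \<Rightarrow> 'a \<Rightarrow> 'a"  (infixr "*\<^sub>C" 75)
  assumes scaleC_add_right: "a *\<^sub>C (x + y) = a *\<^sub>C x + a *\<^sub>C y"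
    and scaleC_add_left: "(a + b) *\<^sub>C x = a *\<^sub>C x + b *\<^sub>C x"
    and scaleC_scaleC: "a *\<^sub>C b *\<^sub>C x = (a * b) *\<^sub>C x"
    and scaleC_of_real: "complex_of_real r *\<^sub>C x = r *\<^sub>R x"

class complex_hilbert_space = complex_space +
  fixes cinner :: "'a \<Rightarrow> 'a \<Rightarrow> complex"
  assumes cinner_commute: "cinner x y = cnj (cinner y x)"
    and cinner_add_left: "cinner (x + y) z = cinner x z + cinner y z"
    and cinner_scaleC_left: "cinner (a *\<^sub>C x) y = a * cinner x y"
    and cinner_nonneg: "cinner x x \<in> \<real>\<^sub>\<ge>\<^sub>0"
    and cinner_eq_zero_iff: "cinner x x = 0 \<longleftrightarrow> x = 0"
    and norm_eq_sqrt_cinner: "norm x = sqrt (Re (cinner x x))"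

instantiation complex :: complex_hilbert_space
begin

definition scaleC_complex :: "complex \<Rightarrow> complex \<Rightarrow> complex"
  where "scaleC_complex a x = a * x"

definition cinner_complex :: "complex \<Rightarrow> complex \<Rightarrow> complex"
  where "cinner_complex x y = x * cnj y"

instance
proof
  fix x y :: complex
  show "cinner x x \<in> \<real>\<^sub>\<ge>\<^sub>0"
    by (simp add: cinner_complex_def complex_mult_cnj complex_nonneg_Reals_iff)
  show "norm x = sqrt (Re (cinner x x))"
    by (simp add: cinner_complex_def complex_mult_cnj cmod_def)
qed (auto simp: scaleC_complex_def cinner_complex_def algebra_simps scaleR_conv_of_real)

end

lemma norm_scaleC: "norm (a *\<^sub>C x) = cmod a * norm x"
  for x :: "'a::complex_hilbert_space"
proof -
  have "cinner (a *\<^sub>C x) (a *\<^sub>C x) = a * cnj (cinner (a *\<^sub>C x) x)"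
    by (metis cinner_commute cinner_scaleC_left)
  also have "\<dots> = complex_of_real ((cmod a)\<^sup>2) * cinner x x"
    by (metis cinner_commute cinner_scaleC_left complex_cnj_mult complex_norm_square mult.assoc)
  finally show ?thesis
    by (simp add: norm_eq_sqrt_cinner[of "a *\<^sub>C x"] norm_eq_sqrt_cinner[of x] real_sqrt_mult
        flip: of_real_power)
qed

text \<open>
  Bounded operators on a complex Hilbert space are the elements of \<^typ>\<open>'a \<Rightarrow>\<^sub>L 'a\<close> that commute
  with complex scalars; the library type itself only requires real linearity.
\<close>

definition complex_linear_op :: "('a::complex_hilbert_space \<Rightarrow>\<^sub>L 'a) \<Rightarrow> bool"
  where "complex_linear_op A \<longleftrightarrow> (\<forall>c x. A (c *\<^sub>C x) = c *\<^sub>C A x)"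

definition selfadjoint_op :: "('a::complex_hilbert_space \<Rightarrow>\<^sub>L 'a) \<Rightarrow> bool"
  where "selfadjoint_op A \<longleftrightarrow> complex_linear_op A \<and> (\<forall>x y. cinner (A x) y = cinner x (A y))"

definition positive_op :: "('a::complex_hilbert_space \<Rightarrow>\<^sub>L 'a) \<Rightarrow> bool"
  where "positive_op A \<longleftrightarrow> selfadjoint_op A \<and> (\<forall>x. cinner (A x) x \<in> \<real>\<^sub>\<ge>\<^sub>0)"

definition invertible_op :: "('a::complex_hilbert_space \<Rightarrow>\<^sub>L 'a) \<Rightarrow> bool"
  where "invertible_op A \<longleftrightarrow>
    (\<exists>X. complex_linear_op X \<and> A o\<^sub>L X = id_blinfun \<and> X o\<^sub>L A = id_blinfun)"

definition loewner_le ::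
    "('a::complex_hilbert_space \<Rightarrow>\<^sub>L 'a) \<Rightarrow> ('a \<Rightarrow>\<^sub>L 'a) \<Rightarrow> bool"  (infix "\<preceq>" 50)
  where "X \<preceq> Y \<longleftrightarrow> selfadjoint_op X \<and> selfadjoint_op Y \<and> positive_op (Y - X)"

lift_definition scalar_op :: "complex \<Rightarrow> 'a::complex_hilbert_space \<Rightarrow>\<^sub>L 'a"
  is "\<lambda>c x. c *\<^sub>C x"
proof
  fix c :: complex and r :: real and x y :: 'a
  show "c *\<^sub>C (x + y) = c *\<^sub>C x + c *\<^sub>C y"
    by (rule scaleC_add_right)
  show "c *\<^sub>C r *\<^sub>R x = r *\<^sub>R c *\<^sub>C x"
    by (simp add: scaleC_scaleC mult.commute flip: scaleC_of_real)
  show "\<exists>K. \<forall>x::'a. norm (c *\<^sub>C x) \<le> norm x * K"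
    by (metis norm_scaleC mult.commute order_refl)
qed

definition spectrum_op :: "('a::complex_hilbert_space \<Rightarrow>\<^sub>L 'a) \<Rightarrow> complex set"
  where "spectrum_op A = {z. \<not> invertible_op (A - scalar_op z)}"

definition poly_op :: "real poly \<Rightarrow> ('a::complex_hilbert_space \<Rightarrow>\<^sub>L 'a) \<Rightarrow> ('a \<Rightarrow>\<^sub>L 'a)"
  where "poly_op q A = (\<Sum>i\<le>degree q. coeff q i *\<^sub>R (((o\<^sub>L) A ^^ i) id_blinfun))"

text \<open>
  Continuous functional calculus of a self-adjoint operator \<open>A\<close>, whose spectrum is a compact set
  of real numbers: \<open>f(A)\<close> is the norm limit of \<open>q\<^sub>n(A)\<close> for any real polynomials \<open>q\<^sub>n\<close> converging
  to \<open>f\<close> uniformly on the spectrum.  It is meaningful when \<open>f\<close> is continuous on the spectrum.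
\<close>

definition functional_calculus ::
    "(real \<Rightarrow> real) \<Rightarrow> ('a::complex_hilbert_space \<Rightarrow>\<^sub>L 'a) \<Rightarrow> ('a \<Rightarrow>\<^sub>L 'a)"
  where "functional_calculus f A =
    (THE X. \<exists>q :: nat \<Rightarrow> real poly.
       uniform_limit {t. complex_of_real t \<in> spectrum_op A} (\<lambda>n. poly (q n)) f sequentially \<and>
       (\<lambda>n. poly_op (q n) A) \<longlonglongrightarrow> X)"

text \<open>
  Only used for positive invertible \<open>A\<close>: the spectrum then lies in \<open>{0<..}\<close>, where
  \<^term>\<open>t powr r\<close> is the usual real power.
\<close>

definition powr_op ::
    "('a::complex_hilbert_space \<Rightarrow>\<^sub>L 'a) \<Rightarrow> real \<Rightarrow> ('a \<Rightarrow>\<^sub>L 'a)"  (infixr "powr\<^sub>o" 80)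
  where "A powr\<^sub>o r = functional_calculus (\<lambda>t. t powr r) A"

definition relative_op ::
    "('a::complex_hilbert_space \<Rightarrow>\<^sub>L 'a) \<Rightarrow> ('a \<Rightarrow>\<^sub>L 'a) \<Rightarrow> ('a \<Rightarrow>\<^sub>L 'a)"
  where "relative_op A B = A powr\<^sub>o (-1/2) o\<^sub>L B o\<^sub>L A powr\<^sub>o (-1/2)"

definition natural_power ::
    "real \<Rightarrow> ('a::complex_hilbert_space \<Rightarrow>\<^sub>L 'a) \<Rightarrow> ('a \<Rightarrow>\<^sub>L 'a) \<Rightarrow> ('a \<Rightarrow>\<^sub>L 'a)"
  where "natural_power r A B = A powr\<^sub>o (1/2) o\<^sub>L relative_op A B powr\<^sub>o r o\<^sub>L A powr\<^sub>o (1/2)"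

text \<open>
  For \<open>r\<close> in \<open>{0..1}\<close> this is the weighted geometric mean, so no separate constant is used for it.
\<close>

definition tsallis_entropy ::
    "real \<Rightarrow> ('a::complex_hilbert_space \<Rightarrow>\<^sub>L 'a) \<Rightarrow> ('a \<Rightarrow>\<^sub>L 'a) \<Rightarrow> ('a \<Rightarrow>\<^sub>L 'a)"
  where "tsallis_entropy p A B = (1 / p) *\<^sub>R (natural_power p A B - A)"

definition K_op ::
    "real \<Rightarrow> ('a::complex_hilbert_space \<Rightarrow>\<^sub>L 'a) \<Rightarrow> ('a \<Rightarrow>\<^sub>L 'a) \<Rightarrow> ('a \<Rightarrow>\<^sub>L 'a)"
  where "K_op p A B =
    A powr\<^sub>o (1/2) o\<^sub>L ((1/2) *\<^sub>R (relative_op A B + id_blinfun)) powr\<^sub>o (p - 1)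
      o\<^sub>L (relative_op A B - id_blinfun) o\<^sub>L A powr\<^sub>o (1/2)"

definition J_op ::
    "real \<Rightarrow> ('a::complex_hilbert_space \<Rightarrow>\<^sub>L 'a) \<Rightarrow> ('a \<Rightarrow>\<^sub>L 'a) \<Rightarrow> ('a \<Rightarrow>\<^sub>L 'a)"
  where "J_op p A B = (1/2) *\<^sub>R (natural_power p A B - natural_power (p - 1) A B + B - A)"

definition L_op ::
    "real \<Rightarrow> ('a::complex_hilbert_space \<Rightarrow>\<^sub>L 'a) \<Rightarrow> ('a \<Rightarrow>\<^sub>L 'a) \<Rightarrow> ('a \<Rightarrow>\<^sub>L 'a)"
  where "L_op p A B = (1/24 * (p - 1) * (p - 2)) *\<^sub>R
    (natural_power p A B - 3 *\<^sub>R natural_power (p - 1) A B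
      + 3 *\<^sub>R natural_power (p - 2) A B - natural_power (p - 3) A B)"

definition R_op ::
    "real \<Rightarrow> ('a::complex_hilbert_space \<Rightarrow>\<^sub>L 'a) \<Rightarrow> ('a \<Rightarrow>\<^sub>L 'a) \<Rightarrow> ('a \<Rightarrow>\<^sub>L 'a)"
  where "R_op p A B = (1/24 * (p - 1) * (p - 2)) *\<^sub>R
    (natural_power 3 A B - 3 *\<^sub>R natural_power 2 A B + 3 *\<^sub>R B - A)"

end

theory Submission
  imports Defs "HOL-Computational_Algebra.Fundamental_Theorem_Algebra"
begin

text \<open>
  Put \<open>C = A^(-1/2) B A^(-1/2)\<close>; then \<open>A \<le> B\<close> means \<open>C \<ge> I\<close>.  Each operator in the statement is
  \<open>A^(1/2) f(C) A^(1/2)\<close> for an explicit scalar function \<open>f\<close>, so the four operator inequalities reduce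
  to scalar ones on the spectrum of \<open>C\<close>, a subset of \<open>[1, \<infinity>)\<close>.  Since \<open>(t^p - 1)/p\<close> is the integral
  of \<open>s^(p-1)\<close> over \<open>[1, t]\<close>, those are the error bounds of the midpoint and of the trapezoid rule:
  the second derivative \<open>(p-1)(p-2)s^(p-3)\<close> lies between its values at \<open>t\<close> and at \<open>1\<close>.

  The reduction rests on the bound of the norm of \<open>q(T)\<close> by the supremum of \<open>|q|\<close> over the
  spectrum, for \<open>T\<close> self-adjoint and \<open>q\<close> a real polynomial.  If \<open>M = \<parallel>q(T)\<parallel>\<close> were larger, then
  \<open>q\<^sup>2 - M\<^sup>2\<close> would have no root on the spectrum, so that all factors of \<open>q(T)\<^sup>2 - M\<^sup>2\<close> would be
  invertible, whereas on a nonzero space \<open>S\<^sup>2 - \<parallel>S\<parallel>\<^sup>2\<close> is never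
  invertible for self-adjoint \<open>S\<close>.
\<close>

subsection \<open>Self-adjoint operators and invertibility\<close>

lemma blinfun_eq_iff: "A = B \<longleftrightarrow> (\<forall>x. blinfun_apply A x = blinfun_apply B x)"
  using blinfun_eqI by auto

text \<open>This is a real inner product that induces the same norm; symmetry, positivity and all
  estimates below are phrased with it.\<close>

definition rinner :: "'a::complex_hilbert_space \<Rightarrow> 'a \<Rightarrow> real"
  where "rinner x y = Re (cinner x y)"

lemma rinner_commute: "rinner x y = rinner y x"
  unfolding rinner_def by (subst cinner_commute) simp

lemma rinner_self: "rinner x x = (norm x)\<^sup>2"
proof -
  have "Re (cinner x x) \<ge> 0"
    using cinner_nonneg[of x] by (auto simp: complex_nonneg_Reals_iff)
  then show ?thesis
    by (simp add: rinner_def norm_eq_sqrt_cinner)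
qed

lemma rinner_add_left: "rinner (x + y) z = rinner x z + rinner y z"
  by (simp add: rinner_def cinner_add_left)

lemma rinner_add_right: "rinner x (y + z) = rinner x y + rinner x z"
  using rinner_add_left[of y z x] by (simp add: rinner_commute)

lemma rinner_scaleR_left: "rinner (r *\<^sub>R x) y = r * rinner x y"
  by (simp add: rinner_def cinner_scaleC_left flip: scaleC_of_real)

text \<open>Cauchy-Schwarz read backwards from the triangle inequality: the squared norm of
  \<open>x + y\<close> is expanded and compared with the square of
  \<open>norm x + norm y\<close>.\<close>

lemma rinner_le_norm: "rinner x y \<le> norm x * norm y"
proof -
  have "(norm (x + y))\<^sup>2 = (norm x)\<^sup>2 + 2 * rinner x y + (norm y)\<^sup>2"
    using rinner_commute[of x y]
    by (simp add: rinner_self[symmetric] rinner_add_left rinner_add_right)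
  moreover have "(norm (x + y))\<^sup>2 \<le> (norm x + norm y)\<^sup>2"
    by (simp add: norm_triangle_ineq power_mono)
  ultimately show ?thesis
    by (simp add: power2_sum)
qed

lemma abs_rinner_le_norm: "\<bar>rinner x y\<bar> \<le> norm x * norm y"
  using rinner_le_norm[of x y] rinner_le_norm[of "- 1 *\<^sub>R x" y] rinner_scaleR_left[of "- 1" x y]
  by simp

lemma bounded_bilinear_rinner: "bounded_bilinear rinner"
proof
  fix a a' b b' :: "'a::complex_hilbert_space" and r :: real
  show "rinner (a + a') b = rinner a b + rinner a' b"
    by (rule rinner_add_left)
  show "rinner a (b + b') = rinner a b + rinner a b'"
    using rinner_add_left[of b b' a] by (simp add: rinner_commute)
  show "rinner (r *\<^sub>R a) b = r *\<^sub>R rinner a b"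
    by (simp add: rinner_scaleR_left)
  show "rinner a (r *\<^sub>R b) = r *\<^sub>R rinner a b"
    using rinner_scaleR_left[of r b a] by (simp add: rinner_commute)
  show "\<exists>K. \<forall>(a::'a) b. norm (rinner a b) \<le> norm a * norm b * K"
    by (rule exI[of _ 1]) (simp add: abs_rinner_le_norm)
qed

interpretation rinner: bounded_bilinear rinner
  by (rule bounded_bilinear_rinner)

lemma norm_diff_sq_rinner: "(norm (x - y))\<^sup>2 = (norm x)\<^sup>2 - 2 * rinner x y + (norm y)\<^sup>2"
  using rinner_commute[of x y]
  by (simp add: rinner_self[symmetric] rinner.diff_left rinner.diff_right)

text \<open>Commutation with fixed bounded operators is an equation between operators, which passes
  to norm limits.\<close>

lemma complex_linear_op_iff_commute:
  "complex_linear_op A \<longleftrightarrow> (\<forall>c. A o\<^sub>L scalar_op c = scalar_op c o\<^sub>L A)"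
  by (auto simp: complex_linear_op_def blinfun_eq_iff scalar_op.rep_eq)

lemma scalar_op_of_real: "scalar_op (complex_of_real r) = r *\<^sub>R id_blinfun"
  by (rule blinfun_eqI) (simp add: scalar_op.rep_eq scaleC_of_real scaleR_blinfun.rep_eq)

lemma complex_linear_op_id: "complex_linear_op id_blinfun"
  by (simp add: complex_linear_op_def)

lemma complex_linear_op_compose:
  "complex_linear_op A \<Longrightarrow> complex_linear_op B \<Longrightarrow> complex_linear_op (A o\<^sub>L B)"
  by (simp add: complex_linear_op_def)

text \<open>The imaginary part of \<open>cinner x y\<close> is the real part with \<open>x\<close>
  multiplied by \<open>- \<i>\<close>, and complex linearity moves this factor through
  \<open>A\<close>.\<close>

lemma selfadjoint_op_iff_rinner:
  "selfadjoint_op A \<longleftrightarrow>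
    complex_linear_op A \<and> (\<forall>x y. rinner (A x) y = rinner x (A y))"
proof safe
  assume "selfadjoint_op A"
  then show "complex_linear_op A" "\<And>x y. rinner (A x) y = rinner x (A y)"
    by (auto simp: selfadjoint_op_def rinner_def)
next
  assume lin: "complex_linear_op A" and sym: "\<forall>x y. rinner (A x) y = rinner x (A y)"
  have Im: "Im (cinner x y) = rinner ((- \<i>) *\<^sub>C x) y" for x y :: 'a
    unfolding rinner_def cinner_scaleC_left by simp
  have "cinner (A x) y = cinner x (A y)" for x y
  proof (rule complex_eqI)
    show "Re (cinner (A x) y) = Re (cinner x (A y))"
      using sym by (simp add: rinner_def)
    show "Im (cinner (A x) y) = Im (cinner x (A y))"
      unfolding Im using sym lin by (metis complex_linear_op_def)
  qed
  then show "selfadjoint_op A"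
    using lin by (simp add: selfadjoint_op_def)
qed

text \<open>For self-adjoint \<open>A\<close> the value \<open>cinner (A x) x\<close> equals its own
  conjugate, so only the sign of its real part is left to test.\<close>

lemma positive_op_iff_rinner:
  "positive_op A \<longleftrightarrow> selfadjoint_op A \<and> (\<forall>x. rinner (A x) x \<ge> 0)"
proof -
  have "Im (cinner (A x) x) = 0" if "selfadjoint_op A" for x
  proof -
    have "cinner (A x) x = cnj (cinner (A x) x)"
      using that by (subst (2) cinner_commute) (simp add: selfadjoint_op_def)
    then show ?thesis
      by (metis Reals_cnj_iff complex_is_Real_iff)
  qed
  then show ?thesis
    by (auto simp: positive_op_def rinner_def complex_nonneg_Reals_iff)
qed

lemma selfadjoint_op_id: "selfadjoint_op id_blinfun"
  by (simp add: selfadjoint_op_iff_rinner complex_linear_op_id)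

lemma selfadjoint_op_add: "selfadjoint_op A \<Longrightarrow> selfadjoint_op B \<Longrightarrow> selfadjoint_op (A + B)"
  by (simp add: selfadjoint_op_iff_rinner complex_linear_op_def plus_blinfun.rep_eq
      scaleC_add_right rinner.add_left rinner.add_right)

lemma selfadjoint_op_scaleR: "selfadjoint_op A \<Longrightarrow> selfadjoint_op (r *\<^sub>R A)"
  by (simp add: selfadjoint_op_iff_rinner complex_linear_op_def scaleR_blinfun.rep_eq
      rinner.scaleR_left rinner.scaleR_right)
    (simp add: scaleC_scaleC mult.commute flip: scaleC_of_real)

lemma selfadjoint_op_diff: "selfadjoint_op A \<Longrightarrow> selfadjoint_op B \<Longrightarrow> selfadjoint_op (A - B)"
  using selfadjoint_op_add[OF _ selfadjoint_op_scaleR[of B "- 1"], of A] by simp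

lemma selfadjoint_op_conjugate:
  "selfadjoint_op S \<Longrightarrow> selfadjoint_op X \<Longrightarrow> selfadjoint_op (S o\<^sub>L X o\<^sub>L S)"
  by (simp add: selfadjoint_op_iff_rinner complex_linear_op_def)

lemma selfadjoint_op_compose_commute:
  "selfadjoint_op A \<Longrightarrow> selfadjoint_op B \<Longrightarrow> A o\<^sub>L B = B o\<^sub>L A \<Longrightarrow> selfadjoint_op (A o\<^sub>L B)"
  by (metis complex_linear_op_compose selfadjoint_op_iff_rinner blinfun_apply_blinfun_compose)

text \<open>Complex linearity and symmetry are both equalities between expressions continuous in the
  operator.\<close>

lemma selfadjoint_op_limit:
  assumes "\<And>n. selfadjoint_op (X n)" "X \<longlonglongrightarrow> Y"
  shows "selfadjoint_op Y"
  unfolding selfadjoint_op_iff_rinner complex_linear_op_iff_commute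
proof safe
  fix c
  have "(\<lambda>n. X n o\<^sub>L scalar_op c) \<longlonglongrightarrow> (Y o\<^sub>L scalar_op c)"
    "(\<lambda>n. scalar_op c o\<^sub>L X n) \<longlonglongrightarrow> (scalar_op c o\<^sub>L Y)"
    by (intro bounded_bilinear.tendsto[OF bounded_bilinear_blinfun_compose] assms tendsto_const)+
  moreover have "X n o\<^sub>L scalar_op c = scalar_op c o\<^sub>L X n" for n
    using assms(1) unfolding selfadjoint_op_iff_rinner complex_linear_op_iff_commute by blast
  ultimately show "Y o\<^sub>L scalar_op c = scalar_op c o\<^sub>L Y"
    by (simp add: LIMSEQ_unique)
next
  fix x y
  have "(\<lambda>n. rinner (X n x) y) \<longlonglongrightarrow> rinner (Y x) y" "(\<lambda>n. rinner x (X n y)) \<longlonglongrightarrow> rinner x (Y y)"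
    by (intro rinner.tendsto blinfun.tendsto assms tendsto_const)+
  moreover have "rinner (X n x) y = rinner x (X n y)" for n
    using assms(1) unfolding selfadjoint_op_iff_rinner by blast
  ultimately show "rinner (Y x) y = rinner x (Y y)"
    by (simp add: LIMSEQ_unique)
qed

section \<open>Invertibility and lower bounds\<close>

lemma invertible_op_compose:
  assumes "invertible_op A" "invertible_op B"
  shows "invertible_op (A o\<^sub>L B)"
proof -
  obtain X Y where X: "complex_linear_op X" "A o\<^sub>L X = id_blinfun" "X o\<^sub>L A = id_blinfun"
    and Y: "complex_linear_op Y" "B o\<^sub>L Y = id_blinfun" "Y o\<^sub>L B = id_blinfun"
    using assms by (auto simp: invertible_op_def)
  have "A o\<^sub>L B o\<^sub>L (Y o\<^sub>L X) = id_blinfun" "Y o\<^sub>L X o\<^sub>L (A o\<^sub>L B) = id_blinfun"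
    using X Y by (simp_all add: blinfun_eq_iff)
  then show ?thesis
    unfolding invertible_op_def using X Y complex_linear_op_compose by blast
qed

lemma invertible_op_scaleR:
  assumes "invertible_op A" "r \<noteq> 0"
  shows "invertible_op (r *\<^sub>R A)"
proof -
  obtain X where X: "complex_linear_op X" "A o\<^sub>L X = id_blinfun" "X o\<^sub>L A = id_blinfun"
    using assms by (auto simp: invertible_op_def)
  have "complex_linear_op (inverse r *\<^sub>R X)"
    using X(1) by (simp add: complex_linear_op_def scaleR_blinfun.rep_eq)
      (simp add: scaleC_scaleC mult.commute flip: scaleC_of_real)
  moreover have "r *\<^sub>R A o\<^sub>L inverse r *\<^sub>R X = id_blinfun" "inverse r *\<^sub>R X o\<^sub>L r *\<^sub>R A = id_blinfun"
    using X assms(2) by (simp_all add: blinfun_eq_iff scaleR_blinfun.rep_eq blinfun.scaleR_right)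
  ultimately show ?thesis
    unfolding invertible_op_def by blast
qed

lemma invertible_op_id: "invertible_op id_blinfun"
  unfolding invertible_op_def
  by (intro exI[of _ id_blinfun]) (simp add: complex_linear_op_id blinfun_eq_iff)

lemma invertible_op_bounded_below:
  assumes "invertible_op A"
  obtains c where "c > 0" "\<And>x. c * norm x \<le> norm (A x)"
proof -
  obtain X where X: "X o\<^sub>L A = id_blinfun"
    using assms by (auto simp: invertible_op_def)
  \<comment> \<open>The \<open>+ 1\<close> keeps the factor positive even if \<open>X = 0\<close>,
    as on the zero space.\<close>
  have "norm x \<le> (norm X + 1) * norm (A x)" for x
  proof -
    have "norm x = norm (X (A x))"
      using X by (metis blinfun_apply_blinfun_compose blinfun_apply_id_blinfun)
    also have "\<dots> \<le> norm X * norm (A x)"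
      by (rule norm_blinfun)
    finally show ?thesis
      by (simp add: algebra_simps add_increasing)
  qed
  moreover have pos: "norm X + 1 > 0"
    by (simp add: add_nonneg_pos)
  ultimately have "inverse (norm X + 1) * norm x \<le> norm (A x)" for x
    by (simp add: field_simps)
  then show ?thesis
    using that[of "inverse (norm X + 1)"] pos by simp
qed

text \<open>The lower bound for \<open>A\<close> is exactly what bounds the inverse, with constant
  \<open>inverse c\<close>.\<close>

lemma blinfun_inverse_of_bij:
  fixes A :: "'a::real_normed_vector \<Rightarrow>\<^sub>L 'a"
  assumes bij: "bij (blinfun_apply A)" and c: "c > 0" "\<And>x. c * norm x \<le> norm (A x)"
  obtains X where "A o\<^sub>L X = id_blinfun" "X o\<^sub>L A = id_blinfun"
proof -
  let ?g = "inv (blinfun_apply A)"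
  have Ag: "A (?g y) = y" for y
    using bij by (simp add: bij_is_surj surj_f_inv_f)
  have gA: "?g (A x) = x" for x
    using bij by (simp add: bij_is_inj)
  have "bounded_linear ?g"
  proof (rule bounded_linear_intro)
    show "?g (x + y) = ?g x + ?g y" for x y
      by (metis Ag gA blinfun.add_right)
    show "?g (r *\<^sub>R x) = r *\<^sub>R ?g x" for r x
      by (metis Ag gA blinfun.scaleR_right)
    show "norm (?g x) \<le> norm x * inverse c" for x
      using c(2)[of "?g x"] c(1) by (simp add: Ag field_simps)
  qed
  then have "A o\<^sub>L Blinfun ?g = id_blinfun" "Blinfun ?g o\<^sub>L A = id_blinfun"
    by (simp_all add: blinfun_eq_iff bounded_linear_Blinfun_apply Ag gA)
  then show ?thesis
    using that by blast
qed

lemma invertible_op_of_bij: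
  assumes lin: "complex_linear_op A" and "bij (blinfun_apply A)"
    and "c > 0" "\<And>x. c * norm x \<le> norm (A x)"
  shows "invertible_op A"
proof -
  obtain X where X: "A o\<^sub>L X = id_blinfun" "X o\<^sub>L A = id_blinfun"
    using blinfun_inverse_of_bij assms(2-4) by blast
  have AX: "A (X y) = y" and XA: "X (A y) = y" for y
    using X by (auto simp: blinfun_eq_iff)
  have "X (d *\<^sub>C x) = d *\<^sub>C X x" for d x
    using lin by (metis AX XA complex_linear_op_def)
  then show ?thesis
    unfolding invertible_op_def using X by (auto simp: complex_linear_op_def)
qed

text \<open>
  No orthogonal projections are needed: \<open>T\<^sup>2 x = y\<close> is solved by iterating
  \<open>x \<mapsto> x - M\<^sup>-\<^sup>2 (T\<^sup>2 x - y)\<close>, which is a contraction once \<open>M\<close> exceeds the norm of \<open>T\<close>.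
\<close>

lemma selfadjoint_op_bounded_below_invertible:
  fixes T :: "'a::complex_hilbert_space \<Rightarrow>\<^sub>L 'a"
  assumes sa: "selfadjoint_op T" and c: "c > 0" "\<And>x. c * norm x \<le> norm (T x)"
  shows "invertible_op T"
proof -
  \<comment> \<open>Adding \<open>c\<close> gives both \<open>M > 0\<close> and
    \<open>c \<le> M\<close>, so the radicand of \<open>k\<close> is nonnegative.\<close>
  define M where "M = norm T + c"
  define k where "k = sqrt (1 - c\<^sup>2 / M\<^sup>2)"
  have M: "M > 0" "c \<le> M"
    using c by (simp_all add: M_def add_nonneg_pos)
  have TM: "norm (T x) \<le> M * norm x" for x
  proof -
    have "norm (T x) \<le> norm T * norm x"
      by (rule norm_blinfun)
    also have "\<dots> \<le> M * norm x"
      using c by (simp add: M_def mult_right_mono)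
    finally show ?thesis .
  qed
  have sym: "rinner x (T (T x)) = (norm (T x))\<^sup>2" for x
    using sa by (metis rinner_self selfadjoint_op_iff_rinner)
  have k: "0 \<le> 1 - c\<^sup>2 / M\<^sup>2" "0 \<le> k" "k < 1"
  proof -
    have "c\<^sup>2 \<le> M\<^sup>2"
      using M c by (simp add: power_mono)
    then show "0 \<le> 1 - c\<^sup>2 / M\<^sup>2"
      using M by simp
    then show "0 \<le> k"
      by (simp add: k_def)
    have "c\<^sup>2 / M\<^sup>2 > 0"
      using M c by simp
    then show "k < 1"
      by (simp add: k_def)
  qed
  \<comment> \<open>In the expansion of the square, the last term is at most half the size of the
    middle one because T is bounded by M. What survives, minus the square of
    \<open>norm (T x) / M\<close>, is estimated by the lower bound \<open>c\<close>.\<close>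
  have contr: "norm (x - (1 / M\<^sup>2) *\<^sub>R T (T x)) \<le> k * norm x" for x
  proof -
    have "(norm (x - (1 / M\<^sup>2) *\<^sub>R T (T x)))\<^sup>2
        = (norm x)\<^sup>2 - 2 * (norm (T x))\<^sup>2 / M\<^sup>2 + ((norm (T (T x)))\<^sup>2 / M\<^sup>2) / M\<^sup>2"
      by (simp add: norm_diff_sq_rinner rinner.scaleR_right sym power_divide)
    also have "\<dots> \<le> (norm x)\<^sup>2 - 2 * (norm (T x))\<^sup>2 / M\<^sup>2 + (norm (T x))\<^sup>2 / M\<^sup>2"
    proof -
      have "(norm (T (T x)))\<^sup>2 \<le> M\<^sup>2 * (norm (T x))\<^sup>2"
        using TM[of "T x"] by (metis norm_ge_zero power_mono power_mult_distrib)
      then have "(norm (T (T x)))\<^sup>2 / M\<^sup>2 \<le> (norm (T x))\<^sup>2"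
        using M by (simp add: field_simps)
      then have "(norm (T (T x)))\<^sup>2 / M\<^sup>2 / M\<^sup>2 \<le> (norm (T x))\<^sup>2 / M\<^sup>2"
        by (rule divide_right_mono) simp
      then show ?thesis
        by linarith
    qed
    also have "\<dots> = (norm x)\<^sup>2 - (norm (T x))\<^sup>2 / M\<^sup>2"
      by simp
    also have "\<dots> \<le> (norm x)\<^sup>2 - (c * norm x)\<^sup>2 / M\<^sup>2"
    proof -
      have "(c * norm x)\<^sup>2 \<le> (norm (T x))\<^sup>2"
        using c by (simp add: power_mono)
      then show ?thesis
        by (simp add: divide_right_mono)
    qed
    also have "\<dots> = (k * norm x)\<^sup>2"
      using k by (simp add: k_def power_mult_distrib algebra_simps)
    finally show ?thesis
      using k by (simp add: power2_le_iff_abs_le)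
  qed
  have "\<exists>x. T (T x) = y" for y
  proof -
    let ?f = "\<lambda>x. x - (1 / M\<^sup>2) *\<^sub>R (T (T x) - y)"
    have "\<exists>!x. ?f x = x"
    proof (rule banach_fix_type)
      show "0 \<le> k" "k < 1"
        by (fact k)+
      show "\<forall>x z. dist (?f x) (?f z) \<le> k * dist x z"
      proof (intro allI)
        fix x z
        have eq: "?f x - ?f z = (x - z) - (1 / M\<^sup>2) *\<^sub>R T (T (x - z))"
          by (simp add: blinfun.diff_right algebra_simps)
        show "dist (?f x) (?f z) \<le> k * dist x z"
          unfolding dist_norm eq by (rule contr)
      qed
    qed
    then show ?thesis
      using M by auto
  qed
  \<comment> \<open>Solvability of \<open>T (T x) = y\<close> puts every \<open>y\<close> in the
    range of \<open>T\<close>.\<close>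
  then have surj: "surj (blinfun_apply T)"
    unfolding surj_def by metis
  have "inj (blinfun_apply T)"
  proof (rule injI)
    fix x y assume "T x = T y"
    then have "c * norm (x - y) \<le> 0"
      using c(2)[of "x - y"] by (simp add: blinfun.diff_right)
    then show "x = y"
      using c(1) by (simp add: mult_le_0_iff)
  qed
  with surj show ?thesis
    using invertible_op_of_bij sa c by (metis bij_def selfadjoint_op_def)
qed

subsection \<open>Polynomials of a self-adjoint operator\<close>

lemma blinfun_compose_sum_right:
  "A o\<^sub>L (\<Sum>i\<in>I. f i) = (\<Sum>i\<in>I. A o\<^sub>L f i)"
  by (rule bounded_bilinear.sum_right[OF bounded_bilinear_blinfun_compose])

lemmas blinfun_compose_simps =
  bounded_bilinear.add_left[OF bounded_bilinear_blinfun_compose]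
  bounded_bilinear.add_right[OF bounded_bilinear_blinfun_compose]
  bounded_bilinear.diff_left[OF bounded_bilinear_blinfun_compose]
  bounded_bilinear.diff_right[OF bounded_bilinear_blinfun_compose]
  bounded_bilinear.scaleR_left[OF bounded_bilinear_blinfun_compose]
  bounded_bilinear.scaleR_right[OF bounded_bilinear_blinfun_compose]

lemma poly_op_0: "poly_op 0 A = 0"
  by (simp add: poly_op_def)

text \<open>Horner's recursion, which reduces the algebraic rules below to induction on
  polynomials.\<close>

lemma poly_op_pCons: "poly_op (pCons a q) A = a *\<^sub>R id_blinfun + (A o\<^sub>L poly_op q A)"
proof (cases "q = 0")
  case True
  then show ?thesis
    by (simp add: poly_op_def)
next
  case False
  then show ?thesis
    by (simp add: poly_op_def sum.atMost_Suc_shift blinfun_compose_sum_right blinfun_compose_simps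
        del: sum.atMost_Suc)
qed

lemma poly_op_add: "poly_op (p + q) A = poly_op p A + poly_op q A"
  by (induction p q rule: poly_induct2)
    (simp_all add: poly_op_0 poly_op_pCons blinfun_compose_simps algebra_simps)

lemma poly_op_smult: "poly_op (smult c p) A = c *\<^sub>R poly_op p A"
  by (induction p)
    (simp_all add: poly_op_0 poly_op_pCons blinfun_compose_simps algebra_simps)

lemma poly_op_diff: "poly_op (p - q) A = poly_op p A - poly_op q A"
  using poly_op_add[of p "smult (- 1) q" A] poly_op_smult[of "- 1" q A] by simp

lemma poly_op_mult: "poly_op (p * q) A = poly_op p A o\<^sub>L poly_op q A"
  by (induction p)
    (simp_all add: poly_op_0 poly_op_pCons poly_op_add poly_op_smult blinfun_compose_simps
      blinfun_eq_iff scaleR_blinfun.rep_eq plus_blinfun.rep_eq)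

lemma poly_op_const: "poly_op [:c:] A = c *\<^sub>R id_blinfun"
  by (simp add: poly_op_pCons poly_op_0 blinfun_eq_iff plus_blinfun.rep_eq)

lemma poly_op_linear: "poly_op [:a, b:] A = a *\<^sub>R id_blinfun + b *\<^sub>R A"
  by (simp add: poly_op_pCons poly_op_0 blinfun_eq_iff plus_blinfun.rep_eq scaleR_blinfun.rep_eq
      blinfun.scaleR_right)

lemma poly_op_pcompose: "poly_op (pcompose p q) A = poly_op p (poly_op q A)"
  by (induction p)
    (simp_all add: poly_op_0 poly_op_pCons pcompose_pCons poly_op_add poly_op_mult poly_op_const)

lemma selfadjoint_poly_op:
  assumes "selfadjoint_op A"
  shows "selfadjoint_op (poly_op q A)"
proof (induction q)
  case 0
  show ?case
    using selfadjoint_op_scaleR[OF selfadjoint_op_id, of 0] by (simp add: poly_op_0)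
next
  case (pCons a q)
  \<comment> \<open>With \<open>A\<close> itself a polynomial in \<open>A\<close>, commutation with
    \<open>poly_op q A\<close> is commutativity of polynomial multiplication.\<close>
  have "A = poly_op [:0, 1:] A"
    by (simp add: poly_op_linear)
  then have "A o\<^sub>L poly_op q A = poly_op q A o\<^sub>L A"
    by (metis poly_op_mult mult.commute)
  then show ?case
    using pCons assms by (simp add: poly_op_pCons selfadjoint_op_add selfadjoint_op_scaleR
        selfadjoint_op_id selfadjoint_op_compose_commute)
qed

section \<open>The real spectrum and its location\<close>

definition real_spectrum :: "('a::complex_hilbert_space \<Rightarrow>\<^sub>L 'a) \<Rightarrow> real set"
  where "real_spectrum A = {t. complex_of_real t \<in> spectrum_op A}"

lemma real_spectrum_iff: "t \<in> real_spectrum A \<longleftrightarrow> \<not> invertible_op (A - t *\<^sub>R id_blinfun)"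
  by (simp add: real_spectrum_def spectrum_op_def scalar_op_of_real)

text \<open>Every localization of the spectrum below is a lower bound for \<open>A - t\<close> fed
  into this criterion.\<close>

lemma not_in_real_spectrum:
  assumes "selfadjoint_op A" "c > 0" "\<And>x. c * norm x \<le> norm (A x - t *\<^sub>R x)"
  shows "t \<notin> real_spectrum A"
proof -
  have "selfadjoint_op (A - t *\<^sub>R id_blinfun)"
    by (intro selfadjoint_op_diff selfadjoint_op_scaleR selfadjoint_op_id assms)
  then show ?thesis
    unfolding real_spectrum_iff
    using selfadjoint_op_bounded_below_invertible[OF _ assms(2), of "A - t *\<^sub>R id_blinfun"] assms(3)
    by (simp add: minus_blinfun.rep_eq scaleR_blinfun.rep_eq)
qed

lemma bounded_below_of_rinner:
  assumes "c * (norm x)\<^sup>2 \<le> rinner y x"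
  shows "c * norm x \<le> norm y"
proof (cases "x = 0")
  case False
  have "c * norm x * norm x \<le> norm y * norm x"
    using assms rinner_le_norm[of y x] by (simp add: power2_eq_square)
  then show ?thesis
    using False by simp
qed simp

lemma real_spectrum_abs_le_norm:
  assumes "selfadjoint_op A" "t \<in> real_spectrum A"
  shows "\<bar>t\<bar> \<le> norm A"
proof (rule ccontr)
  assume "\<not> \<bar>t\<bar> \<le> norm A"
  moreover have "(\<bar>t\<bar> - norm A) * norm x \<le> norm (A x - t *\<^sub>R x)" for x
    using norm_blinfun[of A x] norm_triangle_ineq2[of "t *\<^sub>R x" "A x"]
    by (simp add: algebra_simps norm_minus_commute)
  ultimately show False
    using not_in_real_spectrum[OF assms(1), of "\<bar>t\<bar> - norm A" t] assms(2) by auto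
qed

lemma real_spectrum_ge:
  assumes "selfadjoint_op A" "\<And>x. a * (norm x)\<^sup>2 \<le> rinner (A x) x" "t \<in> real_spectrum A"
  shows "a \<le> t"
proof (rule ccontr)
  assume "\<not> a \<le> t"
  moreover have "(a - t) * norm x \<le> norm (A x - t *\<^sub>R x)" for x
    using assms(2)[of x] by (intro bounded_below_of_rinner)
      (simp add: rinner.diff_left rinner.scaleR_left rinner_self algebra_simps)
  ultimately show False
    using not_in_real_spectrum[OF assms(1), of "a - t" t] assms(3) by auto
qed

text \<open>Positivity gives \<open>0 \<le> t\<close>; then for \<open>t < c\<close> the triangle
  inequality leaves the lower bound \<open>c - t\<close>. The gap at 0 makes real powers continuous
  on an interval containing the spectrum.\<close>

lemma real_spectrum_positive_invertible:
  assumes "positive_op A" "invertible_op A"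
  obtains c where "c > 0" "real_spectrum A \<subseteq> {c..norm A}"
proof -
  have sa: "selfadjoint_op A" and pos: "\<And>x. 0 \<le> rinner (A x) x"
    using assms by (auto simp: positive_op_iff_rinner)
  obtain c where c: "c > 0" "\<And>x. c * norm x \<le> norm (A x)"
    using invertible_op_bounded_below[OF assms(2)] by blast
  have "c \<le> t" if t: "t \<in> real_spectrum A" for t
  proof (rule ccontr)
    assume "\<not> c \<le> t"
    moreover have "0 \<le> t"
      using real_spectrum_ge[OF sa _ t, of 0] pos by simp
    moreover have "(c - t) * norm x \<le> norm (A x - t *\<^sub>R x)" for x
      using c(2)[of x] norm_triangle_ineq2[of "A x" "t *\<^sub>R x"] \<open>0 \<le> t\<close>
      by (simp add: algebra_simps)
    ultimately show False
      using not_in_real_spectrum[OF sa, of "c - t" t] t by auto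
  qed
  moreover have "t \<le> norm A" if "t \<in> real_spectrum A" for t
    using real_spectrum_abs_le_norm[OF sa that] by simp
  ultimately have "real_spectrum A \<subseteq> {c..norm A}"
    by auto
  then show ?thesis
    using that c(1) by blast
qed

text \<open>The operator is the square of \<open>A - a\<close> plus \<open>b\<close> squared, hence
  bounded below. It accounts for a pair of conjugate non-real roots while the coefficients stay
  real.\<close>

lemma invertible_op_quadratic:
  assumes sa: "selfadjoint_op A" and b: "b \<noteq> 0"
  shows "invertible_op (poly_op [:a\<^sup>2 + b\<^sup>2, - 2 * a, 1:] A)" (is "invertible_op ?Q")
proof (rule selfadjoint_op_bounded_below_invertible)
  show "selfadjoint_op ?Q"
    by (rule selfadjoint_poly_op[OF sa])
  show "b\<^sup>2 > 0"
    using b by simp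
  fix x
  define T where "T = A - a *\<^sub>R id_blinfun"
  have T: "selfadjoint_op T"
    unfolding T_def by (intro selfadjoint_op_diff selfadjoint_op_scaleR selfadjoint_op_id sa)
  have "[:a\<^sup>2 + b\<^sup>2, - 2 * a, 1:] = [:- a, 1:] * [:- a, 1:] + [:b\<^sup>2:]"
    by (simp add: power2_eq_square)
  then have "?Q = (T o\<^sub>L T) + b\<^sup>2 *\<^sub>R id_blinfun"
    by (simp only: poly_op_add poly_op_mult poly_op_linear poly_op_const T_def) simp
  then have "rinner (?Q x) x = (norm (T x))\<^sup>2 + b\<^sup>2 * (norm x)\<^sup>2"
    using T by (simp add: plus_blinfun.rep_eq scaleR_blinfun.rep_eq rinner.add_left
        rinner.scaleR_left rinner_self selfadjoint_op_iff_rinner)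
  then show "b\<^sup>2 * norm x \<le> norm (?Q x)"
    by (intro bounded_below_of_rinner) simp
qed

section \<open>Real polynomials: factorization and invertibility\<close>

definition cpoly :: "real poly \<Rightarrow> complex poly"
  where "cpoly = map_poly complex_of_real"

lemma cpoly_pCons: "cpoly (pCons a p) = pCons (complex_of_real a) (cpoly p)"
  by (simp add: cpoly_def map_poly_pCons)

lemma cpoly_0: "cpoly 0 = 0"
  by (simp add: cpoly_def)

lemma cpoly_add: "cpoly (p + q) = cpoly p + cpoly q"
  by (induction p q rule: poly_induct2) (simp_all add: cpoly_0 cpoly_pCons)

lemma cpoly_smult: "cpoly (smult c p) = smult (complex_of_real c) (cpoly p)"
  by (induction p) (simp_all add: cpoly_0 cpoly_pCons)

lemma cpoly_mult: "cpoly (p * q) = cpoly p * cpoly q"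
  by (induction p) (simp_all add: cpoly_0 cpoly_pCons cpoly_add cpoly_smult)

lemma poly_cpoly_of_real: "poly (cpoly p) (complex_of_real t) = complex_of_real (poly p t)"
  by (induction p) (simp_all add: cpoly_0 cpoly_pCons)

text \<open>A complex root exists by the fundamental theorem of algebra. A real one splits off a
  linear factor; a non-real one splits off the quadratic that vanishes at it and at its
  conjugate.\<close>

lemma real_poly_factor:
  fixes q :: "real poly"
  assumes "degree q > 0"
  obtains (linear) t r where "q = [:- t, 1:] * r"
    | (quadratic) a b r where "b \<noteq> 0" "q = [:a\<^sup>2 + b\<^sup>2, - 2 * a, 1:] * r"
proof -
  have "degree (cpoly q) = degree q"
    by (simp add: cpoly_def degree_map_poly)
  then have "\<not> constant (poly (cpoly q))"
    using assms by (simp add: constant_degree)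
  then obtain z where z: "poly (cpoly q) z = 0"
    using fundamental_theorem_of_algebra by blast
  show ?thesis
  proof (cases "Im z = 0")
    case True
    then have "z = complex_of_real (Re z)"
      by (simp add: complex_eq_iff)
    then have "poly q (Re z) = 0"
      using z poly_cpoly_of_real[of q "Re z"] by simp
    then show ?thesis
      using linear by (metis dvdE poly_eq_0_iff_dvd)
  next
    case False
    define Q where "Q = [:(Re z)\<^sup>2 + (Im z)\<^sup>2, - 2 * Re z, 1:]"
    have Qz: "poly (cpoly Q) z = 0"
      by (simp add: Q_def cpoly_pCons cpoly_0 complex_eq_iff power2_eq_square algebra_simps)
    have q: "q = Q * (q div Q) + q mod Q"
      by simp
    then have "poly (cpoly (q mod Q)) z = 0"
      using z Qz by (metis add_0 cpoly_add cpoly_mult mult_zero_left poly_add poly_mult)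
    moreover have "degree (q mod Q) < 2"
    proof -
      have "degree Q = 2" "Q \<noteq> 0"
        by (simp_all add: Q_def)
      then show ?thesis
        using degree_mod_less[of Q q] by auto
    qed
    then obtain u v where uv: "q mod Q = [:u, v:]"
      using degree1_coeffs by (metis One_nat_def less_2_cases_iff pCons_0_0 degree_eq_zeroE)
    ultimately have "complex_of_real u + z * complex_of_real v = 0"
      by (simp add: cpoly_pCons cpoly_0)
    \<comment> \<open>The remainder is real of degree at most 1; the imaginary part of its value at
      \<open>z\<close> is \<open>v * Im z\<close>, and \<open>Im z\<close> is nonzero.\<close>
    then have "v = 0" "u = 0"
      using False by (auto simp: complex_eq_iff)
    then show ?thesis
      using quadratic[OF False, of "Re z" "q div Q"] q uv by (simp add: Q_def)
  qed
qed

text \<open>Induction on the degree, splitting off one factor: a linear one has its root off the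
  spectrum by hypothesis, a quadratic one is always invertible.\<close>

lemma invertible_poly_op:
  assumes sa: "selfadjoint_op A" and "q \<noteq> 0" and "\<And>t. t \<in> real_spectrum A \<Longrightarrow> poly q t \<noteq> 0"
  shows "invertible_op (poly_op q A)"
  using assms(2,3)
proof (induction "degree q" arbitrary: q rule: less_induct)
  case less
  show ?case
  proof (cases "degree q = 0")
    case True
    then obtain c where "q = [:c:]" "c \<noteq> 0"
      using less.prems(1) by (metis degree_eq_zeroE pCons_0_0)
    then show ?thesis
      by (simp add: poly_op_const invertible_op_scaleR invertible_op_id)
  next
    case False
    have *: ?thesis if qr: "q = s * r" and s: "degree s > 0" "invertible_op (poly_op s A)" for s r
    proof -
      have nz: "s \<noteq> 0" "r \<noteq> 0"
        using less.prems(1) qr by auto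
      then have "degree r < degree q"
        using s by (simp add: qr degree_mult_eq)
      then have "invertible_op (poly_op r A)"
        using less.hyps[of r] less.prems(2) nz qr by auto
      then show ?thesis
        using s by (simp add: qr poly_op_mult invertible_op_compose)
    qed
    from False have "degree q > 0"
      by simp
    then show ?thesis
    proof (cases rule: real_poly_factor)
      case (linear t r)
      then have "t \<notin> real_spectrum A"
        using less.prems(2)[of t] by auto
      then have "invertible_op (poly_op [:- t, 1:] A)"
        by (simp add: real_spectrum_iff poly_op_linear)
      then show ?thesis
        using *[OF linear] by simp
    next
      case (quadratic a b r)
      then show ?thesis
        using *[OF quadratic(2)] invertible_op_quadratic[OF sa] by simp
    qed
  qed
qed

text \<open>A lower bound \<open>c\<close> for the operator \<open>?S\<close> would improve the
  bound on \<open>T\<close> from \<open>M\<close> to the square root of \<open>k\<close>, which is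
  less than the norm.\<close>

lemma norm_sq_in_spectrum_square:
  fixes T :: "'a::complex_hilbert_space \<Rightarrow>\<^sub>L 'a"
  assumes sa: "selfadjoint_op T" and nt: "(UNIV :: 'a set) \<noteq> {0}"
  shows "\<not> invertible_op ((T o\<^sub>L T) - (norm T)\<^sup>2 *\<^sub>R id_blinfun)" (is "\<not> invertible_op ?S")
proof
  assume "invertible_op ?S"
  then obtain c where c: "c > 0" "\<And>x. c * norm x \<le> norm (?S x)"
    using invertible_op_bounded_below by blast
  define M where "M = norm T"
  have Sx: "?S x = T (T x) - M\<^sup>2 *\<^sub>R x" for x
    by (simp add: M_def minus_blinfun.rep_eq scaleR_blinfun.rep_eq)
  have sym: "rinner (T (T x)) x = (norm (T x))\<^sup>2" for x
    using sa by (metis rinner_self selfadjoint_op_iff_rinner)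
  show False
  proof (cases "M = 0")
    case True
    then have "T = 0"
      by (simp add: M_def)
    then have "norm (?S x) = 0" for x
      using Sx[of x] True by simp
    then have "c * norm x \<le> 0" for x :: 'a
      using c(2)[of x] by metis
    then have "x = 0" for x :: 'a
      using c(1) by (simp add: mult_le_0_iff)
    then show False
      using nt by auto
  next
    case False
    then have M: "M > 0"
      by (simp add: M_def)
    \<comment> \<open>The square of \<open>norm (?S x)\<close> is expanded, and
      \<open>norm (T (T x))\<close> is bounded by \<open>M * norm (T x)\<close>.\<close>
    have key: "c\<^sup>2 * (norm x)\<^sup>2 \<le> M\<^sup>2 * (M\<^sup>2 * (norm x)\<^sup>2 - (norm (T x))\<^sup>2)" for x
    proof -
      have "c\<^sup>2 * (norm x)\<^sup>2 \<le> (norm (?S x))\<^sup>2"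
        using c power_mono[OF c(2)[of x], of 2] by (simp add: power_mult_distrib)
      also have "\<dots> = (norm (T (T x)))\<^sup>2 - 2 * (M\<^sup>2 * (norm (T x))\<^sup>2) + M\<^sup>2 * M\<^sup>2 * (norm x)\<^sup>2"
        unfolding Sx norm_diff_sq_rinner
        by (simp add: rinner.scaleR_right sym power2_eq_square)
      also have "(norm (T (T x)))\<^sup>2 \<le> M\<^sup>2 * (norm (T x))\<^sup>2"
        using power_mono[OF norm_blinfun[of T "T x"], of 2] by (simp add: M_def power_mult_distrib)
      finally show ?thesis
        by (simp add: algebra_simps)
    qed
    define k where "k = M\<^sup>2 - c\<^sup>2 / M\<^sup>2"
    have bound: "(norm (T x))\<^sup>2 \<le> k * (norm x)\<^sup>2" for x
      using key[of x] M by (simp add: k_def field_simps)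
    \<comment> \<open>The absolute value stands in until a nonzero vector shows
      \<open>k \<ge> 0\<close>.\<close>
    have "norm (T x) \<le> sqrt \<bar>k\<bar> * norm x" for x
    proof -
      have "(norm (T x))\<^sup>2 \<le> \<bar>k\<bar> * (norm x)\<^sup>2"
        using order_trans[OF bound[of x] mult_right_mono[OF abs_ge_self]] by simp
      then have "sqrt ((norm (T x))\<^sup>2) \<le> sqrt (\<bar>k\<bar> * (norm x)\<^sup>2)"
        by (rule real_sqrt_le_mono)
      then show ?thesis
        by (simp add: real_sqrt_mult)
    qed
    then have "M \<le> sqrt \<bar>k\<bar>"
      unfolding M_def by (intro norm_blinfun_bound) auto
    then have "M\<^sup>2 \<le> \<bar>k\<bar>"
      using M power_mono[of M "sqrt \<bar>k\<bar>" 2] by simp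
    moreover obtain x :: 'a where "x \<noteq> 0"
      using nt by auto
    then have "k \<ge> 0"
      using order_trans[OF zero_le_power2 bound[of x]] by (simp add: zero_le_mult_iff)
    ultimately have "c\<^sup>2 / M\<^sup>2 \<le> 0"
      by (simp add: k_def)
    then show False
      using c(1) M by (simp add: divide_le_0_iff)
  qed
qed

text \<open>On an empty spectrum the polynomial \<open>x^2 - (norm A)^2\<close> would have no root,
  contradicting the preceding lemma.\<close>

lemma real_spectrum_nonempty:
  fixes A :: "'a::complex_hilbert_space \<Rightarrow>\<^sub>L 'a"
  assumes "selfadjoint_op A" "(UNIV :: 'a set) \<noteq> {0}"
  shows "real_spectrum A \<noteq> {}"
proof
  assume "real_spectrum A = {}"
  then have "invertible_op (poly_op [:- (norm A)\<^sup>2, 0, 1:] A)"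
    using invertible_poly_op[OF assms(1), of "[:- (norm A)\<^sup>2, 0, 1:]"] by simp
  moreover have "poly_op [:- (norm A)\<^sup>2, 0, 1:] A = (A o\<^sub>L A) - (norm A)\<^sup>2 *\<^sub>R id_blinfun"
    by (simp add: poly_op_pCons poly_op_0 blinfun_eq_iff plus_blinfun.rep_eq minus_blinfun.rep_eq
        scaleR_blinfun.rep_eq)
  ultimately show False
    using norm_sq_in_spectrum_square[OF assms] by simp
qed

text \<open>Uniqueness, existence and positivity of the functional calculus all come from this
  estimate.\<close>

lemma norm_poly_op_le:
  fixes A :: "'a::complex_hilbert_space \<Rightarrow>\<^sub>L 'a"
  assumes sa: "selfadjoint_op A" and e: "e \<ge> 0"
    and bound: "\<And>t. t \<in> real_spectrum A \<Longrightarrow> \<bar>poly q t\<bar> \<le> e"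
  shows "norm (poly_op q A) \<le> e"
proof (rule ccontr)
  assume "\<not> norm (poly_op q A) \<le> e"
  then have M: "e < norm (poly_op q A)"
    by simp
  have nt: "(UNIV :: 'a set) \<noteq> {0}"
  proof
    assume "(UNIV :: 'a set) = {0}"
    then have "(x :: 'a) = y" for x y
      by (metis UNIV_I singletonD)
    then have "poly_op q A = 0"
      by (intro blinfun_eqI) blast
    then show False
      using M e by simp
  qed
  define r where "r = q * q - [:(norm (poly_op q A))\<^sup>2:]"
  have r: "poly r t \<noteq> 0" if "t \<in> real_spectrum A" for t
  proof -
    have "\<bar>poly q t\<bar> < norm (poly_op q A)"
      using bound[OF that] M by linarith
    then have "\<bar>poly q t\<bar>\<^sup>2 < (norm (poly_op q A))\<^sup>2"
      by (intro power_strict_mono) auto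
    then show ?thesis
      by (simp add: r_def power2_eq_square)
  qed
  \<comment> \<open>A spectral point is where \<open>r\<close> is seen to be a nonzero
    polynomial.\<close>
  obtain t where "t \<in> real_spectrum A"
    using real_spectrum_nonempty[OF sa nt] by blast
  then have "r \<noteq> 0"
    using r[of t] by auto
  then have "invertible_op (poly_op r A)"
    using invertible_poly_op[OF sa] r by blast
  then show False
    using norm_sq_in_spectrum_square[OF selfadjoint_poly_op[OF sa] nt, of q]
    by (simp add: r_def poly_op_diff poly_op_mult poly_op_const)
qed

subsection \<open>Continuous functional calculus\<close>

text \<open>This is the predicate under \<open>THE\<close> in \<open>functional_calculus\<close>,
  kept as a relation so that the algebraic rules can be proved before uniqueness.\<close>

definition has_calculus ::
    "(real \<Rightarrow> real) \<Rightarrow> ('a::complex_hilbert_space \<Rightarrow>\<^sub>L 'a) \<Rightarrow> ('a \<Rightarrow>\<^sub>L 'a) \<Rightarrow> bool"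
  where "has_calculus f A X \<longleftrightarrow> (\<exists>q :: nat \<Rightarrow> real poly.
    uniform_limit (real_spectrum A) (\<lambda>n. poly (q n)) f sequentially \<and>
    (\<lambda>n. poly_op (q n) A) \<longlonglongrightarrow> X)"

lemma poly_fun_simps:
  fixes p q :: "real poly"
  shows
  "poly (p + q) = (\<lambda>t. poly p t + poly q t)"
  "poly (smult c p) = (\<lambda>t. c * poly p t)"
  "poly (p * q) = (\<lambda>t. poly p t * poly q t)"
  "poly [:c:] = (\<lambda>_. c)"
  "poly [:0, 1::real:] = (\<lambda>t. t)"
  by (rule ext, simp)+

lemma has_calculus_poly: "has_calculus (poly q) A (poly_op q A)"
  unfolding has_calculus_def by (rule exI[of _ "\<lambda>_. q"]) (simp add: uniform_limit_const)

lemma has_calculus_cong: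
  "has_calculus f A X \<Longrightarrow> (\<And>t. t \<in> real_spectrum A \<Longrightarrow> f t = g t) \<Longrightarrow> has_calculus g A X"
  unfolding has_calculus_def by (metis (no_types, lifting) uniform_limit_cong')

lemma has_calculus_const: "has_calculus (\<lambda>_. c) A (c *\<^sub>R id_blinfun)"
  using has_calculus_poly[of "[:c:]" A] by (simp add: poly_fun_simps poly_op_const)

lemma has_calculus_one: "has_calculus (\<lambda>_. 1) A id_blinfun"
  using has_calculus_const[of 1 A] by simp

lemma has_calculus_ident: "has_calculus (\<lambda>t. t) A A"
  using has_calculus_poly[of "[:0, 1:]" A] by (simp add: poly_fun_simps poly_op_linear)

lemma has_calculus_add:
  assumes "has_calculus f A X" "has_calculus g A Y"
  shows "has_calculus (\<lambda>t. f t + g t) A (X + Y)"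
proof -
  obtain q r where
    q: "uniform_limit (real_spectrum A) (\<lambda>n. poly (q n)) f sequentially"
    "(\<lambda>n. poly_op (q n) A) \<longlonglongrightarrow> X"
    and r: "uniform_limit (real_spectrum A) (\<lambda>n. poly (r n)) g sequentially"
    "(\<lambda>n. poly_op (r n) A) \<longlonglongrightarrow> Y"
    using assms unfolding has_calculus_def by blast
  show ?thesis
    unfolding has_calculus_def
  proof (intro exI[of _ "\<lambda>n. q n + r n"] conjI)
    show "uniform_limit (real_spectrum A) (\<lambda>n. poly (q n + r n)) (\<lambda>t. f t + g t) sequentially"
      unfolding poly_fun_simps by (rule uniform_limit_add[OF q(1) r(1)])
    show "(\<lambda>n. poly_op (q n + r n) A) \<longlonglongrightarrow> X + Y"
      unfolding poly_op_add by (rule tendsto_add[OF q(2) r(2)])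
  qed
qed

lemma has_calculus_scaleR:
  assumes "has_calculus f A X"
  shows "has_calculus (\<lambda>t. c * f t) A (c *\<^sub>R X)"
proof -
  obtain q where
    q: "uniform_limit (real_spectrum A) (\<lambda>n. poly (q n)) f sequentially"
    "(\<lambda>n. poly_op (q n) A) \<longlonglongrightarrow> X"
    using assms unfolding has_calculus_def by blast
  show ?thesis
    unfolding has_calculus_def
  proof (intro exI[of _ "\<lambda>n. smult c (q n)"] conjI)
    show "uniform_limit (real_spectrum A) (\<lambda>n. poly (smult c (q n))) (\<lambda>t. c * f t) sequentially"
      unfolding poly_fun_simps
      by (rule bounded_linear.uniform_limit[OF bounded_linear_mult_right q(1)])
    show "(\<lambda>n. poly_op (smult c (q n)) A) \<longlonglongrightarrow> c *\<^sub>R X"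
      unfolding poly_op_smult by (rule tendsto_scaleR[OF tendsto_const q(2)])
  qed
qed

lemma has_calculus_diff:
  assumes "has_calculus f A X" "has_calculus g A Y"
  shows "has_calculus (\<lambda>t. f t - g t) A (X - Y)"
  using has_calculus_add[OF assms(1) has_calculus_scaleR[OF assms(2), of "- 1"]] by simp

lemma has_calculus_norm_le:
  \<comment> \<open>The slack \<open>d\<close> introduced below absorbs the uniform error of the
    approximating polynomials.\<close>
  assumes sa: "selfadjoint_op A" and X: "has_calculus f A X" and e: "e \<ge> 0"
    and bound: "\<And>t. t \<in> real_spectrum A \<Longrightarrow> \<bar>f t\<bar> \<le> e"
  shows "norm X \<le> e"
proof (rule field_le_epsilon)
  fix d :: real assume d: "d > 0"
  obtain q where q: "uniform_limit (real_spectrum A) (\<lambda>n. poly (q n)) f sequentially"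
    "(\<lambda>n. poly_op (q n) A) \<longlonglongrightarrow> X"
    using X unfolding has_calculus_def by blast
  have "eventually (\<lambda>n. \<forall>t\<in>real_spectrum A. dist (poly (q n) t) (f t) < d) sequentially"
    using uniform_limitD[OF q(1) d] .
  then have "eventually (\<lambda>n. norm (poly_op (q n) A) \<le> e + d) sequentially"
  proof eventually_elim
    case (elim n)
    show ?case
    proof (rule norm_poly_op_le[OF sa])
      fix t assume t: "t \<in> real_spectrum A"
      then have "\<bar>poly (q n) t - f t\<bar> < d"
        using elim by (auto simp: dist_real_def)
      then show "\<bar>poly (q n) t\<bar> \<le> e + d"
        using bound[OF t] by linarith
    qed (use e d in simp)
  qed
  moreover have "(\<lambda>n. norm (poly_op (q n) A)) \<longlonglongrightarrow> norm X"
    by (rule tendsto_norm[OF q(2)])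
  ultimately show "norm X \<le> e + d"
    by (metis tendsto_upperbound trivial_limit_sequentially)
qed

text \<open>The difference of two values represents the zero function, so its norm is at most
  0.\<close>

lemma has_calculus_unique:
  assumes "selfadjoint_op A" "has_calculus f A X" "has_calculus f A Y"
  shows "X = Y"
  using has_calculus_norm_le[OF assms(1) has_calculus_diff[OF assms(2,3)], of 0] by simp

lemma functional_calculus_eq:
  assumes "selfadjoint_op A" "has_calculus f A X"
  shows "functional_calculus f A = X"
proof -
  have "functional_calculus f A = (THE X. has_calculus f A X)"
    unfolding functional_calculus_def has_calculus_def real_spectrum_def ..
  also have "\<dots> = X"
    using assms has_calculus_unique by blast
  finally show ?thesis .
qed

lemma selfadjoint_has_calculus:
  assumes "selfadjoint_op A" "has_calculus f A X"
  shows "selfadjoint_op X"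
  using assms selfadjoint_poly_op selfadjoint_op_limit unfolding has_calculus_def by metis

text \<open>Some polynomial is within 1 of \<open>f\<close> on the spectrum and is bounded on a
  compact interval containing it. Uniform convergence of products relies on this.\<close>

lemma has_calculus_bounded:
  assumes "selfadjoint_op A" "has_calculus f A X"
  shows "bounded (f ` real_spectrum A)"
proof -
  obtain q where q: "uniform_limit (real_spectrum A) (\<lambda>n. poly (q n)) f sequentially"
    using assms(2) unfolding has_calculus_def by blast
  obtain n where n: "\<forall>t\<in>real_spectrum A. dist (poly (q n) t) (f t) < 1"
    using uniform_limitD[OF q, of 1] by (auto simp: eventually_sequentially)
  have "compact (poly (q n) ` {- norm A..norm A})"
    by (rule compact_continuous_image[OF continuous_on_poly[OF continuous_on_id] compact_Icc])
  then have "bounded (poly (q n) ` {- norm A..norm A})"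
    by (rule compact_imp_bounded)
  then obtain b where b: "\<forall>t\<in>{- norm A..norm A}. \<bar>poly (q n) t\<bar> \<le> b"
    unfolding bounded_real by (auto simp del: atLeastAtMost_iff)
  have "\<bar>f t\<bar> \<le> b + 1" if t: "t \<in> real_spectrum A" for t
  proof -
    have "t \<in> {- norm A..norm A}"
      using real_spectrum_abs_le_norm[OF assms(1) t] by auto
    then have "\<bar>poly (q n) t\<bar> \<le> b"
      using b by blast
    moreover have "\<bar>poly (q n) t - f t\<bar> < 1"
      using n t by (auto simp: dist_real_def)
    ultimately show ?thesis
      by linarith
  qed
  then show ?thesis
    by (auto simp: bounded_real)
qed

lemma has_calculus_mult:
  assumes sa: "selfadjoint_op A" and X: "has_calculus f A X" and Y: "has_calculus g A Y"
  shows "has_calculus (\<lambda>t. f t * g t) A (X o\<^sub>L Y)"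
proof -
  obtain q r where
    q: "uniform_limit (real_spectrum A) (\<lambda>n. poly (q n)) f sequentially"
    "(\<lambda>n. poly_op (q n) A) \<longlonglongrightarrow> X"
    and r: "uniform_limit (real_spectrum A) (\<lambda>n. poly (r n)) g sequentially"
    "(\<lambda>n. poly_op (r n) A) \<longlonglongrightarrow> Y"
    using X Y unfolding has_calculus_def by blast
  have b: "bounded (f ` real_spectrum A)" "bounded (g ` real_spectrum A)"
    using has_calculus_bounded sa X Y by blast+
  show ?thesis
    unfolding has_calculus_def
  proof (intro exI[of _ "\<lambda>n. q n * r n"] conjI)
    show "uniform_limit (real_spectrum A) (\<lambda>n. poly (q n * r n)) (\<lambda>t. f t * g t) sequentially"
      unfolding poly_fun_simps by (rule uniform_lim_mult[OF q(1) r(1) b])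
    show "(\<lambda>n. poly_op (q n * r n) A) \<longlonglongrightarrow> (X o\<^sub>L Y)"
      unfolding poly_op_mult
      by (rule bounded_bilinear.tendsto[OF bounded_bilinear_blinfun_compose q(2) r(2)])
  qed
qed

text \<open>From \<open>0 \<le> f \<le> c\<close> follows \<open>\<bar>c - f\<bar> \<le> c\<close>,
  so the norm bound for \<open>c - X\<close> caps its quadratic form by that of
  \<open>c\<close>.\<close>

lemma has_calculus_positive:
  assumes sa: "selfadjoint_op A" and X: "has_calculus f A X"
    and nonneg: "\<And>t. t \<in> real_spectrum A \<Longrightarrow> f t \<ge> 0"
  shows "positive_op X"
  unfolding positive_op_iff_rinner
proof (intro conjI allI)
  show "selfadjoint_op X"
    by (rule selfadjoint_has_calculus[OF sa X])
  fix x
  obtain b where b: "\<And>t. t \<in> real_spectrum A \<Longrightarrow> \<bar>f t\<bar> \<le> b"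
    using has_calculus_bounded[OF sa X] by (auto simp: bounded_real)
  \<comment> \<open>On an empty spectrum \<open>b\<close> could be negative.\<close>
  define c where "c = max b 0"
  have "norm (c *\<^sub>R id_blinfun - X) \<le> c"
  proof (rule has_calculus_norm_le[OF sa has_calculus_diff[OF has_calculus_const X]])
    show "\<bar>c - f t\<bar> \<le> c" if "t \<in> real_spectrum A" for t
      using b[OF that] nonneg[OF that] by (simp add: c_def)
  qed (simp add: c_def)
  then have "norm ((c *\<^sub>R id_blinfun - X) x) \<le> c * norm x"
    by (metis norm_blinfun mult_right_mono norm_ge_zero order_trans)
  then have "rinner ((c *\<^sub>R id_blinfun - X) x) x \<le> c * norm x * norm x"
    by (metis rinner_le_norm mult_right_mono norm_ge_zero order_trans)
  then show "rinner (X x) x \<ge> 0"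
    by (simp add: minus_blinfun.rep_eq scaleR_blinfun.rep_eq rinner.diff_left rinner.scaleR_left
        rinner_self power2_eq_square)
qed

text \<open>Weierstrass supplies polynomials converging uniformly to \<open>f\<close>; the norm
  bound makes their values at \<open>A\<close> a Cauchy sequence in a complete space.\<close>

lemma has_calculus_exists:
  assumes sa: "selfadjoint_op A" and sp: "real_spectrum A \<subseteq> {a..b}"
    and cont: "continuous_on {a..b} f"
  obtains X where "has_calculus f A X"
proof -
  have "\<exists>q. \<forall>t\<in>{a..b}. \<bar>f t - poly q t\<bar> < inverse (real (Suc n))" for n
  proof -
    obtain g where g: "real_polynomial_function g"
      "\<And>t. t \<in> {a..b} \<Longrightarrow> \<bar>f t - g t\<bar> < inverse (real (Suc n))"
      using Stone_Weierstrass_real_polynomial_function[OF compact_Icc cont, of "inverse (real (Suc n))"]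
      by auto
    obtain c m where "g = (\<lambda>x. \<Sum>i\<le>m. c i * x ^ i)"
      using g(1) by (auto simp: real_polynomial_function_iff_sum)
    then have "g t = poly (\<Sum>i\<le>m. monom (c i) i) t" for t
      by (simp add: poly_sum poly_monom)
    then show ?thesis
      using g(2) by metis
  qed
  then obtain q where q: "\<And>n t. t \<in> {a..b} \<Longrightarrow> \<bar>f t - poly (q n) t\<bar> < inverse (real (Suc n))"
    by metis
  have lim: "uniform_limit (real_spectrum A) (\<lambda>n. poly (q n)) f sequentially"
  proof (rule uniform_limitI)
    fix e :: real assume "e > 0"
    then obtain N where N: "inverse (real (Suc N)) < e"
      using reals_Archimedean by blast
    show "eventually (\<lambda>n. \<forall>t\<in>real_spectrum A. dist (poly (q n) t) (f t) < e) sequentially"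
    proof (intro eventually_sequentiallyI ballI)
      fix n t assume "N \<le> n" "t \<in> real_spectrum A"
      then have "\<bar>f t - poly (q n) t\<bar> < inverse (real (Suc n))"
        using q sp by blast
      also have "\<dots> \<le> inverse (real (Suc N))"
        using \<open>N \<le> n\<close> by simp
      finally show "dist (poly (q n) t) (f t) < e"
        using N by (simp add: dist_real_def abs_minus_commute)
    qed
  qed
  have "Cauchy (\<lambda>n. poly_op (q n) A)"
  proof (rule CauchyI)
    fix e :: real assume e: "e > 0"
    \<comment> \<open>Two errors below \<open>e / 4\<close> sum to at most \<open>e / 2\<close>; the
      norm bound is non-strict, so this leaves room for the strict \<open>e\<close>.\<close>
    then obtain N where N: "\<And>n. n \<ge> N \<Longrightarrow> \<forall>t\<in>real_spectrum A. dist (poly (q n) t) (f t) < e / 4"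
      using uniform_limitD[OF lim, of "e / 4"] by (auto simp: eventually_sequentially)
    show "\<exists>N. \<forall>m\<ge>N. \<forall>n\<ge>N. norm (poly_op (q m) A - poly_op (q n) A) < e"
    proof (intro exI allI impI)
      fix m n assume mn: "N \<le> m" "N \<le> n"
      have "norm (poly_op (q m - q n) A) \<le> e / 2"
      proof (rule norm_poly_op_le[OF sa])
        fix t assume t: "t \<in> real_spectrum A"
        have "dist (poly (q m) t) (f t) < e / 4" "dist (poly (q n) t) (f t) < e / 4"
          using N mn t by blast+
        then show "\<bar>poly (q m - q n) t\<bar> \<le> e / 2"
          by (simp add: dist_real_def abs_if split: if_splits)
      qed (use e in simp)
      then show "norm (poly_op (q m) A - poly_op (q n) A) < e"
        using e by (simp add: poly_op_diff)
    qed
  qed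
  then obtain X where "(\<lambda>n. poly_op (q n) A) \<longlonglongrightarrow> X"
    by (metis Cauchy_convergent_iff convergent_def)
  then show ?thesis
    using that[of X] lim unfolding has_calculus_def by blast
qed

text \<open>\<open>K_op\<close> contains a power of the mean of \<open>C\<close> and the identity.
  Substituting the affine map into the approximating polynomials turns it into a function of
  \<open>C\<close>.\<close>

lemma has_calculus_affine:
  fixes C :: "'a::complex_hilbert_space \<Rightarrow>\<^sub>L 'a"
  assumes Y: "has_calculus g (a *\<^sub>R C + b *\<^sub>R id_blinfun) Y" and a: "a \<noteq> 0"
  shows "has_calculus (\<lambda>t. g (a * t + b)) C Y"
proof -
  let ?D = "a *\<^sub>R C + b *\<^sub>R id_blinfun"
  obtain q where q: "uniform_limit (real_spectrum ?D) (\<lambda>n. poly (q n)) g sequentially"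
    "(\<lambda>n. poly_op (q n) ?D) \<longlonglongrightarrow> Y"
    using Y unfolding has_calculus_def by blast
  have sp: "a * t + b \<in> real_spectrum ?D" if "t \<in> real_spectrum C" for t
  proof -
    have "C - t *\<^sub>R id_blinfun = inverse a *\<^sub>R (?D - (a * t + b) *\<^sub>R id_blinfun)"
      using a by (simp add: algebra_simps)
    then show ?thesis
      using that invertible_op_scaleR[of _ "inverse a"] a unfolding real_spectrum_iff
      by (metis nonzero_imp_inverse_nonzero)
  qed
  have D: "poly_op [:b, a:] C = ?D"
    by (simp add: poly_op_linear)
  show ?thesis
    unfolding has_calculus_def
  proof (intro exI[of _ "\<lambda>n. pcompose (q n) [:b, a:]"] conjI)
    show "(\<lambda>n. poly_op (pcompose (q n) [:b, a:]) C) \<longlonglongrightarrow> Y"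
      using q(2) by (simp add: poly_op_pcompose D)
    show "uniform_limit (real_spectrum C) (\<lambda>n. poly (pcompose (q n) [:b, a:]))
        (\<lambda>t. g (a * t + b)) sequentially"
    proof (rule uniform_limitI)
      fix e :: real assume "e > 0"
      from uniform_limitD[OF q(1) this]
      show "eventually (\<lambda>n. \<forall>t\<in>real_spectrum C.
          dist (poly (pcompose (q n) [:b, a:]) t) (g (a * t + b)) < e) sequentially"
        by eventually_elim (use sp in \<open>auto simp: poly_pcompose algebra_simps\<close>)
    qed
  qed
qed

lemma has_calculus_powr:
  assumes sa: "selfadjoint_op A" and sp: "real_spectrum A \<subseteq> {c..d}" and c: "c > 0"
  shows "has_calculus (\<lambda>t. t powr r) A (A powr\<^sub>o r)"
proof -
  have "continuous_on {c..d} (\<lambda>t. t powr r)"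
    by (intro continuous_intros) (use c in auto)
  then obtain X where "has_calculus (\<lambda>t. t powr r) A X"
    using has_calculus_exists[OF sa sp] by blast
  then show ?thesis
    using functional_calculus_eq[OF sa] by (simp add: powr_op_def)
qed

lemma positive_op_conjugate:
  assumes "selfadjoint_op S" "positive_op X"
  shows "positive_op (S o\<^sub>L X o\<^sub>L S)"
  using assms selfadjoint_op_conjugate[OF assms(1), of X]
  by (simp add: positive_op_iff_rinner) (metis selfadjoint_op_iff_rinner)

text \<open>The bridge from scalars to operators: the calculus makes \<open>Y - X\<close> positive,
  and conjugation by \<open>S\<close> preserves positivity.\<close>

lemma loewner_le_conjugate_calculus:
  assumes sa: "selfadjoint_op C" "selfadjoint_op S"
    and X: "has_calculus f C X" and Y: "has_calculus g C Y"
    and le: "\<And>t. t \<in> real_spectrum C \<Longrightarrow> f t \<le> g t"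
  shows "(S o\<^sub>L X o\<^sub>L S) \<preceq> (S o\<^sub>L Y o\<^sub>L S)"
proof -
  have "positive_op (Y - X)"
    using has_calculus_positive[OF sa(1) has_calculus_diff[OF Y X]] le by simp
  then have "positive_op (S o\<^sub>L (Y - X) o\<^sub>L S)"
    using sa(2) positive_op_conjugate by blast
  then show ?thesis
    unfolding loewner_le_def using selfadjoint_has_calculus[OF sa(1)] X Y sa(2)
    by (simp add: selfadjoint_op_conjugate blinfun_compose_simps)
qed

subsection \<open>Midpoint and trapezoid rule\<close>

lemma nonneg_of_nonneg_deriv:
  fixes g g' :: "real \<Rightarrow> real"
  assumes "\<And>x. x \<in> {0..H} \<Longrightarrow> (g has_real_derivative g' x) (at x)"
    and "\<And>x. x \<in> {0..H} \<Longrightarrow> g' x \<ge> 0" and "g 0 = 0" and "h \<in> {0..H}"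
  shows "g h \<ge> 0"
proof -
  have "g 0 \<le> g h"
  proof (rule DERIV_nonneg_imp_nondecreasing[of 0 h g])
    show "0 \<le> h"
      using assms(4) by simp
    show "\<exists>y. (g has_real_derivative y) (at x) \<and> 0 \<le> y" if "0 \<le> x" "x \<le> h" for x :: real
      using assms(1)[of x] assms(2)[of x] assms(4) that by (intro exI[of _ "g' x"]) simp
  qed
  then show ?thesis
    using assms(3) by simp
qed

text \<open>Both errors are viewed as functions of the half-width \<open>h\<close> around the
  midpoint \<open>m\<close>. They vanish at 0 and have nonnegative derivatives, obtained in turn
  from \<open>c \<le> f''\<close>.\<close>

lemma midpoint_trapezoid_bounds:
  fixes F f f' f'' :: "real \<Rightarrow> real"
  assumes ab: "a \<le> b"
    and F: "\<And>x. x \<in> {a..b} \<Longrightarrow> (F has_real_derivative f x) (at x)"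
    and f: "\<And>x. x \<in> {a..b} \<Longrightarrow> (f has_real_derivative f' x) (at x)"
    and f': "\<And>x. x \<in> {a..b} \<Longrightarrow> (f' has_real_derivative f'' x) (at x)"
    and c: "\<And>x. x \<in> {a..b} \<Longrightarrow> c \<le> f'' x"
  shows "c * (b - a) ^ 3 / 24 + (b - a) * f ((a + b) / 2) \<le> F b - F a" (is ?mid)
    and "F b - F a \<le> (b - a) * (f a + f b) / 2 - c * (b - a) ^ 3 / 12" (is ?trap)
proof -
  define m where "m = (a + b) / 2"
  define H where "H = (b - a) / 2"
  have H: "H \<ge> 0" "m + H = b" "m - H = a" "b - a = 2 * H"
    using ab by (auto simp: m_def H_def field_simps)
  have in_ab: "m + h \<in> {a..b}" "m - h \<in> {a..b}" if "h \<in> {0..H}" for h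
    using that H by auto
  have right: "((\<lambda>h. g (m + h)) has_real_derivative d) (at h)"
    if "(g has_real_derivative d) (at (m + h))" for g d h
    using that by (simp add: DERIV_shift add.commute[of m])
  have left: "((\<lambda>h. g (m - h)) has_real_derivative - d) (at h)"
    if "(g has_real_derivative d) (at (m - h))" for g d h
  proof -
    have "((\<lambda>h. m - h) has_real_derivative - 1) (at h)"
      by (auto intro!: derivative_eq_intros)
    then show ?thesis
      using DERIV_chain2[of g d "\<lambda>h. m - h" h "- 1" UNIV] that by simp
  qed
  note D = right[OF F[OF in_ab(1)]] left[OF F[OF in_ab(2)]]
    right[OF f[OF in_ab(1)]] left[OF f[OF in_ab(2)]]
    right[OF f'[OF in_ab(1)]] left[OF f'[OF in_ab(2)]]
  have pos2: "f' (m + h) - f' (m - h) - 2 * c * h \<ge> 0" if "h \<in> {0..H}" for h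
  proof (rule nonneg_of_nonneg_deriv[where g = "\<lambda>h. f' (m + h) - f' (m - h) - 2 * c * h",
        OF _ _ _ that])
    fix x assume x: "x \<in> {0..H}"
    show "((\<lambda>h. f' (m + h) - f' (m - h) - 2 * c * h) has_real_derivative
        f'' (m + x) + f'' (m - x) - 2 * c) (at x)"
      by (rule derivative_eq_intros D[OF x] refl | simp)+
    show "f'' (m + x) + f'' (m - x) - 2 * c \<ge> 0"
      using c[OF in_ab(1)[OF x]] c[OF in_ab(2)[OF x]] by simp
  qed simp
  have pos1: "f (m + h) + f (m - h) - 2 * f m - c * h\<^sup>2 \<ge> 0" if "h \<in> {0..H}" for h
  proof (rule nonneg_of_nonneg_deriv[where g = "\<lambda>h. f (m + h) + f (m - h) - 2 * f m - c * h\<^sup>2",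
        OF _ _ _ that])
    fix x assume x: "x \<in> {0..H}"
    show "((\<lambda>h. f (m + h) + f (m - h) - 2 * f m - c * h\<^sup>2) has_real_derivative
        f' (m + x) - f' (m - x) - 2 * c * x) (at x)"
      by (rule derivative_eq_intros D[OF x] refl | simp)+
  qed (use pos2 in auto)
  have "H \<in> {0..H}"
    using H by simp
  note nonneg_at_H = nonneg_of_nonneg_deriv[OF _ _ _ this]
  have "F (m + H) - F (m - H) - 2 * H * f m - c * H ^ 3 / 3 \<ge> 0"
  proof (rule nonneg_at_H[where g = "\<lambda>h. F (m + h) - F (m - h) - 2 * h * f m - c * h ^ 3 / 3"])
    fix x assume x: "x \<in> {0..H}"
    show "((\<lambda>h. F (m + h) - F (m - h) - 2 * h * f m - c * h ^ 3 / 3) has_real_derivative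
        f (m + x) + f (m - x) - 2 * f m - c * x\<^sup>2) (at x)"
      by (rule derivative_eq_intros D[OF x] refl | simp)+
  qed (use pos1 in auto)
  \<comment> \<open>The constants 24 here and 12 in the trapezoid rule arise from
    \<open>H ^ 3 / 3\<close> and \<open>2 * H ^ 3 / 3\<close> on rewriting with the full width
    \<open>2 * H\<close>.\<close>
  then have "c * (2 * H) ^ 3 / 24 + 2 * H * f m \<le> F (m + H) - F (m - H)"
    by (simp add: power_mult_distrib)
  then have "c * (b - a) ^ 3 / 24 + (b - a) * f m \<le> F b - F a"
    unfolding H(2-4) .
  then show ?mid
    unfolding m_def .
  have "H * (f (m + H) + f (m - H)) - (F (m + H) - F (m - H)) - 2 * c * H ^ 3 / 3 \<ge> 0"
  proof (rule nonneg_at_H[where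
        g = "\<lambda>h. h * (f (m + h) + f (m - h)) - (F (m + h) - F (m - h)) - 2 * c * h ^ 3 / 3"])
    fix x assume x: "x \<in> {0..H}"
    have "((\<lambda>h. h * (f (m + h) + f (m - h)) - (F (m + h) - F (m - h)) - 2 * c * h ^ 3 / 3)
        has_real_derivative (f (m + x) + f (m - x)) + (f' (m + x) - f' (m - x)) * x
          - (f (m + x) + f (m - x)) - 2 * c * x\<^sup>2) (at x)"
      by (rule derivative_eq_intros D[OF x] refl | simp)+
    \<comment> \<open>The values of \<open>f\<close> cancel, leaving \<open>x\<close> times the
      expression in \<open>pos2\<close>.\<close>
    then show "((\<lambda>h. h * (f (m + h) + f (m - h)) - (F (m + h) - F (m - h)) - 2 * c * h ^ 3 / 3)
        has_real_derivative x * (f' (m + x) - f' (m - x) - 2 * c * x)) (at x)"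
      by (simp add: algebra_simps power2_eq_square)
    show "x * (f' (m + x) - f' (m - x) - 2 * c * x) \<ge> 0"
      using pos2[OF x] x by simp
  qed simp
  then have "F (m + H) - F (m - H) \<le> 2 * H * (f (m - H) + f (m + H)) / 2 - c * (2 * H) ^ 3 / 12"
    by (simp add: power_mult_distrib algebra_simps)
  then show ?trap
    unfolding H(2-4) .
qed

text \<open>
  Scalar counterparts: with \<open>C = A^(-1/2) B A^(-1/2)\<close>, each operator \<open>X\<close> of the theorem is
  \<open>A^(1/2) f(C) A^(1/2)\<close> for the corresponding \<open>f\<close>.
\<close>

definition tsallis_fun :: "real \<Rightarrow> real \<Rightarrow> real"
  where "tsallis_fun p t = (1 / p) * (t powr p - 1)"

definition K_fun :: "real \<Rightarrow> real \<Rightarrow> real"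
  where "K_fun p t = ((1/2) * t + 1/2) powr (p - 1) * (t - 1)"

definition J_fun :: "real \<Rightarrow> real \<Rightarrow> real"
  where "J_fun p t = (1/2) * (t powr p - t powr (p - 1) + t - 1)"

definition L_fun :: "real \<Rightarrow> real \<Rightarrow> real"
  where "L_fun p t = (1/24 * (p - 1) * (p - 2)) *
    (t powr p - 3 * t powr (p - 1) + 3 * t powr (p - 2) - t powr (p - 3))"

definition R_fun :: "real \<Rightarrow> real \<Rightarrow> real"
  where "R_fun p t = (1/24 * (p - 1) * (p - 2)) * (t powr 3 - 3 * t powr 2 + 3 * t - 1)"

text \<open>Midpoint and trapezoid rule for the integral of \<open>s^(p-1)\<close> over \<open>[1, t]\<close>.\<close>

lemma tsallis_fun_bounds:
  fixes p t :: real
  assumes p: "0 < p" "p \<le> 1" and t: "t \<ge> 1"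
  shows "L_fun p t + K_fun p t \<le> tsallis_fun p t"
    and "tsallis_fun p t \<le> R_fun p t + K_fun p t"
    and "J_fun p t - 2 * R_fun p t \<le> tsallis_fun p t"
    and "tsallis_fun p t \<le> J_fun p t - 2 * L_fun p t"
proof -
  define k where "k = (p - 1) * (p - 2)"
  have k: "k \<ge> 0"
    using p by (simp add: k_def mult_nonpos_nonpos)
  define F where "F = (\<lambda>x. x powr p / p)"
  define f where "f = (\<lambda>x. x powr (p - 1))"
  define f' where "f' = (\<lambda>x. (p - 1) * x powr (p - 2))"
  define f'' where "f'' = (\<lambda>x. k * x powr (p - 3))"
  have F: "(F has_real_derivative f x) (at x)"
    and f: "(f has_real_derivative f' x) (at x)"
    and f': "(f' has_real_derivative f'' x) (at x)" if "x \<in> {1..t}" for x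
    unfolding F_def f_def f'_def f''_def k_def
    using that p by (auto intro!: derivative_eq_intros simp: algebra_simps)
  have lower: "k * t powr (p - 3) \<le> f'' x" and upper: "- k \<le> - f'' x" if x: "x \<in> {1..t}" for x
  proof -
    have "t powr (p - 3) \<le> x powr (p - 3)" "x powr (p - 3) \<le> 1"
      using powr_mono2'[of "p - 3" x t] powr_mono2'[of "p - 3" 1 x] x p by auto
    then show "k * t powr (p - 3) \<le> f'' x" "- k \<le> - f'' x"
      using k mult_left_mono[of "x powr (p - 3)" 1 k] by (auto simp: f''_def mult_left_mono)
  qed
  note lo = midpoint_trapezoid_bounds[OF t F f f' lower]
  \<comment> \<open>Upper bounds on \<open>f''\<close> become lower bounds after negating
    \<open>F\<close>, which reverses both error estimates.\<close>
  note up = midpoint_trapezoid_bounds[OF t DERIV_minus[OF F] DERIV_minus[OF f] DERIV_minus[OF f'] upper]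
  have cube: "t powr p - 3 * t powr (p - 1) + 3 * t powr (p - 2) - t powr (p - 3)
      = t powr (p - 3) * (t - 1) ^ 3"
  proof -
    have "t powr (p - 3 + of_nat n) = t powr (p - 3) * t ^ n" for n
      using t by (simp add: powr_add powr_realpow)
    from this[of 1] this[of 2] this[of 3] show ?thesis
      by (simp add: power3_eq_cube power2_eq_square algebra_simps)
  qed
  have cube1: "t powr 3 - 3 * t powr 2 + 3 * t - 1 = (t - 1) ^ 3"
    using t by (simp add: power3_eq_cube power2_eq_square algebra_simps)
  \<comment> \<open>\<open>L_fun\<close> and \<open>R_fun\<close> are the midpoint corrections for
    the two bounds on the second derivative; the trapezoid corrections are twice as large.\<close>
  have L: "L_fun p t = k * t powr (p - 3) * (t - 1) ^ 3 / 24"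
    unfolding L_fun_def cube by (simp add: k_def)
  have R: "R_fun p t = k * (t - 1) ^ 3 / 24"
    unfolding R_fun_def cube1 by (simp add: k_def)
  have K: "K_fun p t = (t - 1) * f ((1 + t) / 2)"
    by (simp add: K_fun_def f_def add_divide_distrib add.commute)
  have T: "tsallis_fun p t = F t - F 1"
    by (simp add: tsallis_fun_def F_def diff_divide_distrib)
  have J: "J_fun p t = (t - 1) * (f 1 + f t) / 2"
  proof -
    have "t powr (p - 1 + 1) = t powr (p - 1) * t"
      using t by (simp only: powr_add) simp
    then show ?thesis
      by (simp add: J_fun_def f_def algebra_simps)
  qed
  show "L_fun p t + K_fun p t \<le> tsallis_fun p t"
    unfolding L K T using lo(1) by simp
  show "tsallis_fun p t \<le> R_fun p t + K_fun p t"
    unfolding R K T using up(1) by simp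
  show "J_fun p t - 2 * R_fun p t \<le> tsallis_fun p t"
  proof -
    have "(t - 1) * (- f 1 + - f t) / 2 = - ((t - 1) * (f 1 + f t) / 2)"
      by (simp add: field_simps)
    then show ?thesis
      unfolding R J T using up(2) by simp
  qed
  show "tsallis_fun p t \<le> J_fun p t - 2 * L_fun p t"
    unfolding L J T using lo(2) by (simp add: mult_ac)
qed

subsection \<open>Operator inequalities\<close>

lemma positive_op_selfadjoint: "positive_op A \<Longrightarrow> selfadjoint_op A"
  by (simp add: positive_op_def)

lemma powr_op_half:
  fixes A :: "'a::complex_hilbert_space \<Rightarrow>\<^sub>L 'a"
  assumes "positive_op A" "invertible_op A"
  shows "A powr\<^sub>o (1/2) o\<^sub>L A powr\<^sub>o (1/2) = A"
    and "A powr\<^sub>o (1/2) o\<^sub>L A powr\<^sub>o (- 1/2) = id_blinfun"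
    and "A powr\<^sub>o (- 1/2) o\<^sub>L A powr\<^sub>o (1/2) = id_blinfun"
    and "A powr\<^sub>o (- 1/2) o\<^sub>L A o\<^sub>L A powr\<^sub>o (- 1/2) = id_blinfun"
    and "selfadjoint_op (A powr\<^sub>o r)"
proof -
  have sa: "selfadjoint_op A"
    using assms(1) by (rule positive_op_selfadjoint)
  obtain c where c: "c > 0" "real_spectrum A \<subseteq> {c..norm A}"
    using real_spectrum_positive_invertible[OF assms] by blast
  have pos: "t > 0" if "t \<in> real_spectrum A" for t
    using c that by force
  note hc = has_calculus_powr[OF sa c(2,1)]
  show "selfadjoint_op (A powr\<^sub>o r)"
    by (rule selfadjoint_has_calculus[OF sa hc])
  \<comment> \<open>Exponents add because the calculus is multiplicative and its values are
    unique.\<close>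
  have product: "A powr\<^sub>o r o\<^sub>L A powr\<^sub>o s = X"
    if "has_calculus (\<lambda>t. t powr (r + s)) A X" for r s X
    by (rule has_calculus_unique[OF sa has_calculus_mult[OF sa hc hc]])
      (use that in \<open>simp add: powr_add\<close>)
  have one: "has_calculus (\<lambda>t. t powr 1) A A"
    by (rule has_calculus_cong[OF has_calculus_ident]) (use pos in force)
  \<comment> \<open>Since \<open>0 powr 0\<close> is 0, agreement with the constant 1 rests on the
    spectrum avoiding 0.\<close>
  have zero: "has_calculus (\<lambda>t. t powr 0) A id_blinfun"
    by (rule has_calculus_cong[OF has_calculus_one]) (use pos in force)
  show half: "A powr\<^sub>o (1/2) o\<^sub>L A powr\<^sub>o (1/2) = A"
    by (rule product) (use one in simp)
  show "A powr\<^sub>o (1/2) o\<^sub>L A powr\<^sub>o (- 1/2) = id_blinfun"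
    by (rule product) (use zero in simp)
  then show "A powr\<^sub>o (- 1/2) o\<^sub>L A o\<^sub>L A powr\<^sub>o (- 1/2) = id_blinfun"
    and inverse: "A powr\<^sub>o (- 1/2) o\<^sub>L A powr\<^sub>o (1/2) = id_blinfun"
  proof -
    assume right: "A powr\<^sub>o (1/2) o\<^sub>L A powr\<^sub>o (- 1/2) = id_blinfun"
    show left: "A powr\<^sub>o (- 1/2) o\<^sub>L A powr\<^sub>o (1/2) = id_blinfun"
      by (rule product) (use zero in simp)
    have "A x = (A powr\<^sub>o (1/2)) ((A powr\<^sub>o (1/2)) x)" for x
      using half by (simp add: blinfun_eq_iff)
    then show "A powr\<^sub>o (- 1/2) o\<^sub>L A o\<^sub>L A powr\<^sub>o (- 1/2) = id_blinfun"
      using left right by (simp add: blinfun_eq_iff)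
  qed
qed

theorem theorem2:
  fixes A B :: "'a::complex_hilbert_space \<Rightarrow>\<^sub>L 'a" and p :: real
  assumes "positive_op A" and "invertible_op A"
    and "positive_op B" and "invertible_op B"
    and "A \<preceq> B"
    and "0 < p" and "p \<le> 1"
  shows "(L_op p A B + K_op p A B \<preceq> tsallis_entropy p A B \<and>
          tsallis_entropy p A B \<preceq> R_op p A B + K_op p A B) \<and>
         (J_op p A B - 2 *\<^sub>R R_op p A B \<preceq> tsallis_entropy p A B \<and>
          tsallis_entropy p A B \<preceq> J_op p A B - 2 *\<^sub>R L_op p A B)"
proof -
  define S where "S = A powr\<^sub>o (1/2)"
  define V where "V = A powr\<^sub>o (- 1/2)"
  define C where "C = relative_op A B"
  note half = powr_op_half[OF assms(1,2)]
  have SS: "S o\<^sub>L S = A" and SV: "S o\<^sub>L V = id_blinfun" and VS: "V o\<^sub>L S = id_blinfun"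
    and VAV: "V o\<^sub>L A o\<^sub>L V = id_blinfun" and saS: "selfadjoint_op S" and saV: "selfadjoint_op V"
    unfolding S_def V_def by (fact half)+
  have C: "C = V o\<^sub>L B o\<^sub>L V"
    by (simp add: C_def relative_op_def V_def)
  have saC: "selfadjoint_op C"
    unfolding C by (rule selfadjoint_op_conjugate[OF saV positive_op_selfadjoint[OF assms(3)]])
  have SCS: "S o\<^sub>L C o\<^sub>L S = B"
    using SV VS by (simp add: C blinfun_eq_iff)
  \<comment> \<open>Conjugating \<open>A \<preceq> B\<close> by \<open>V\<close> yields
    \<open>C \<ge> I\<close>, stated as a quadratic form bound for
    \<open>real_spectrum_ge\<close>.\<close>
  have C_ge: "1 * (norm x)\<^sup>2 \<le> rinner (C x) x" for x
  proof -
    have "positive_op (V o\<^sub>L (B - A) o\<^sub>L V)"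
      using assms(5) saV by (intro positive_op_conjugate) (auto simp: loewner_le_def)
    moreover have "V o\<^sub>L (B - A) o\<^sub>L V = C - id_blinfun"
      using VAV by (simp add: C blinfun_compose_simps)
    ultimately show ?thesis
      by (simp add: positive_op_iff_rinner minus_blinfun.rep_eq rinner.diff_left rinner_self)
  qed
  have ge1: "1 \<le> t" if "t \<in> real_spectrum C" for t
    using real_spectrum_ge[OF saC C_ge that] .
  have spC: "real_spectrum C \<subseteq> {1..norm C}"
    using ge1 real_spectrum_abs_le_norm[OF saC] by force
  have powr: "has_calculus (\<lambda>t. t powr r) C (C powr\<^sub>o r)" for r
    by (rule has_calculus_powr[OF saC spC]) simp

  \<comment> \<open>\<open>D\<close> inherits the lower bound 1 from \<open>C\<close>; the written
    form fits \<open>has_calculus_affine\<close>.\<close>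
  define D where "D = (1/2) *\<^sub>R C + (1/2) *\<^sub>R id_blinfun"
  have saD: "selfadjoint_op D"
    unfolding D_def by (intro selfadjoint_op_add selfadjoint_op_scaleR selfadjoint_op_id saC)
  have D_ge: "1 * (norm x)\<^sup>2 \<le> rinner (D x) x" for x
    using C_ge[of x] by (simp add: D_def plus_blinfun.rep_eq scaleR_blinfun.rep_eq
        rinner.add_left rinner.scaleR_left rinner_self)
  have spD: "real_spectrum D \<subseteq> {1..norm D}"
    using real_spectrum_ge[OF saD D_ge] real_spectrum_abs_le_norm[OF saD] by force
  have powrD: "has_calculus (\<lambda>t. ((1/2) * t + 1/2) powr (p - 1)) C (D powr\<^sub>o (p - 1))"
    by (rule has_calculus_affine) (use has_calculus_powr[OF saD spD] in \<open>simp_all add: D_def\<close>)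

  note calculus_intros = has_calculus_add has_calculus_diff has_calculus_scaleR
    has_calculus_mult[OF saC] powrD powr has_calculus_one has_calculus_ident
  \<comment> \<open>These are the middle factors left after stripping \<open>S\<close> from both
    sides; their terms mirror the scalar functions so that the calculus rules apply
    structurally.\<close>
  define XT where "XT = (1 / p) *\<^sub>R (C powr\<^sub>o p - id_blinfun)"
  define XK where "XK = D powr\<^sub>o (p - 1) o\<^sub>L (C - id_blinfun)"
  define XJ where "XJ = (1/2) *\<^sub>R (C powr\<^sub>o p - C powr\<^sub>o (p - 1) + C - id_blinfun)"
  define XL where "XL = (1/24 * (p - 1) * (p - 2)) *\<^sub>R
    (C powr\<^sub>o p - 3 *\<^sub>R C powr\<^sub>o (p - 1) + 3 *\<^sub>R C powr\<^sub>o (p - 2) - C powr\<^sub>o (p - 3))"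
  define XR where "XR = (1/24 * (p - 1) * (p - 2)) *\<^sub>R
    (C powr\<^sub>o 3 - 3 *\<^sub>R C powr\<^sub>o 2 + 3 *\<^sub>R C - id_blinfun)"
  have T: "has_calculus (tsallis_fun p) C XT"
    unfolding XT_def tsallis_fun_def[abs_def] by (intro calculus_intros)
  have K: "has_calculus (K_fun p) C XK"
    unfolding XK_def K_fun_def[abs_def] by (intro calculus_intros)
  have J: "has_calculus (J_fun p) C XJ"
    unfolding XJ_def J_fun_def[abs_def] by (intro calculus_intros)
  have L: "has_calculus (L_fun p) C XL"
    unfolding XL_def L_fun_def[abs_def] by (intro calculus_intros)
  have R: "has_calculus (R_fun p) C XR"
    unfolding XR_def R_fun_def[abs_def] by (intro calculus_intros)

  have nat_pow: "natural_power r A B = S o\<^sub>L C powr\<^sub>o r o\<^sub>L S" for r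
    by (simp add: natural_power_def S_def C_def)
  have SIS: "S o\<^sub>L id_blinfun o\<^sub>L S = A"
    using SS by (simp add: blinfun_eq_iff)
  \<comment> \<open>Conjugation by \<open>S\<close> is linear; it sends the identity to
    \<open>A\<close> and \<open>C\<close> to \<open>B\<close>.\<close>
  have eqT: "tsallis_entropy p A B = S o\<^sub>L XT o\<^sub>L S"
    by (simp add: tsallis_entropy_def XT_def nat_pow blinfun_compose_simps SIS)
  have eqJ: "J_op p A B = S o\<^sub>L XJ o\<^sub>L S"
    by (simp add: J_op_def XJ_def nat_pow blinfun_compose_simps SIS SCS)
  have eqL: "L_op p A B = S o\<^sub>L XL o\<^sub>L S"
    by (simp add: L_op_def XL_def nat_pow blinfun_compose_simps)
  have eqR: "R_op p A B = S o\<^sub>L XR o\<^sub>L S"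
    by (simp add: R_op_def XR_def nat_pow blinfun_compose_simps SIS SCS)
  have eqK: "K_op p A B = S o\<^sub>L XK o\<^sub>L S"
    by (simp add: K_op_def XK_def S_def C_def D_def scaleR_add_right blinfun_eq_iff)
  note le = loewner_le_conjugate_calculus[OF saC saS]
  note bounds = tsallis_fun_bounds[OF assms(6,7) ge1]
  have "L_op p A B + K_op p A B \<preceq> tsallis_entropy p A B"
    using le[OF has_calculus_add[OF L K] T bounds(1)]
    by (simp add: eqL eqK eqT blinfun_compose_simps)
  moreover have "tsallis_entropy p A B \<preceq> R_op p A B + K_op p A B"
    using le[OF T has_calculus_add[OF R K] bounds(2)]
    by (simp add: eqR eqK eqT blinfun_compose_simps)
  moreover have "J_op p A B - 2 *\<^sub>R R_op p A B \<preceq> tsallis_entropy p A B"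
    using le[OF has_calculus_diff[OF J has_calculus_scaleR[OF R]] T bounds(3)]
    by (simp add: eqR eqJ eqT blinfun_compose_simps)
  moreover have "tsallis_entropy p A B \<preceq> J_op p A B - 2 *\<^sub>R L_op p A B"
    using le[OF T has_calculus_diff[OF J has_calculus_scaleR[OF L]] bounds(4)]
    by (simp add: eqL eqJ eqT blinfun_compose_simps)
  ultimately show ?thesis
    by blast
qed

end
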